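(* Let $(\Gamma,\mathcal G)$ be a boundary pair associated with $\mathfrak h$, let $z,w\in\mathbb C\setminus\sigma(H^D)$ and $\lambda\in\mathbb R\setminus\sigma(H^D)$. (i) For $\phi,\psi\in\mathcal G^{1/2}$ the expression $\mathfrak l_z(\phi,\psi):=(\mathfrak h-z\mathfrak 1)(S(z)\phi,g)$, where $g\in\mathcal H^1$ with $\Gamma g=\psi$, is well-defined (i.e. independent of the choice of $g$) and defines a family of sesquilinear forms $\mathfrak l_z\colon\mathcal G^{1/2}\times\mathcal G^{1/2}\to\mathbb C$, $z\in\mathbb C\setminus\sigma(H^D)$, which is symmetric, i.e. $\mathfrak l_z^*=\mathfrak l_{\overline z}$. (ii) For all $\phi,\psi\in\mathcal G^{1/2}$, $$\mathfrak l_z(\phi,\psi)-\mathfrak l_w(\phi,\psi)=-(z-w)\langle S(z)\phi,S(\overline w)\psi\rangle_{\mathcal H}=-(z-w)\langle S(w)\phi,S(\overline z)\psi\rangle_{\mathcal H}.$$ (iii) $\mathfrak l_z$ is bounded on $\mathcal G^{1/2}\times\mathcal G^{1/2}$: $|\mathfrak l_z(\phi,\psi)|\le L(z)\|\phi\|_{\mathcal G^{1/2}}\|\psi\|_{\mathcal G^{1/2}}$, where $L(z):=1+|z+1|\,\|S(z)\|_{\mathcal G^{1/2}\to\mathcal H^1}\le 1+|z+1|\,C^1(z,-1)$. (iv) The quadratic form $\mathfrak l_\lambda(\phi):=\mathfrak l_\lambda(\phi,\phi)$ is non-negative for $\lambda\le0$, and closed for $\lambda<0$ as a form in $\mathcal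 G$ with $\operatorname{dom}\mathfrak l_\lambda=\mathcal G^{1/2}$. (v) If $\lambda_1\le\lambda_2$ (real) and $\lambda_1,\lambda_2\notin\sigma(H^D)$, then $\mathfrak l_{\lambda_1}\ge\mathfrak l_{\lambda_2}$, i.e. $\mathfrak l_{\lambda_1}(\phi)\ge\mathfrak l_{\lambda_2}(\phi)$ for all $\phi\in\mathcal G^{1/2}$. (vi) For all $\phi,\psi\in\mathcal G^{1/2}$ the function $z\mapsto\mathfrak l_z(\phi,\psi)$ is holomorphic on $\mathbb C\setminus\sigma(H^D)$. Its derivatives are bounded sesquilinear forms on $\mathcal G^{1/2}\times\mathcal G^{1/2}$ given by $$\mathfrak l_z'(\phi,\psi)=-\langle S(z)\phi,S(\overline z)\psi\rangle_{\mathcal H},\qquad \mathfrak l_z^{(k)}(\phi,\psi)=-k!\,\langle R^D(z)^{k-1}S(z)\phi,S(\overline z)\psi\rangle_{\mathcal H}\quad(k\ge1).$$ In particular, if $\lambda\in\mathbb R\setminus\sigma(H^D)$, then $\mathfrak l_\lambda'\le0$. (vii) For $\phi\in\mathcal G^{1/2}$, $(\operatorname{Im}\mathfrak l_z)(\phi)=-(\operatorname{Im}z)\|S(z)\phi\|_{\mathcal H}^2$, and this is $\le0$ provided $\operatorname{Im}z\ge0$. In particular, $(-\mathfrak l_z)_z$ is a form-valued Nevanlinna function.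
   Context: All Hilbert spaces are complex; inner products and sesquilinear forms are linear in the first argument. Let $\mathfrak h$ be a closed, non-negative, densely defined quadratic form in a Hilbert space $\mathcal H$ (the same symbol denotes its sesquilinear form), with domain $\mathcal H^1:=\operatorname{dom}\mathfrak h$, a Hilbert space with norm $\|u\|_{\mathcal H^1}^2=\mathfrak h(u)+\|u\|_{\mathcal H}^2$; $\mathfrak 1(u,v)=\langle u,v\rangle_{\mathcal H}$. A boundary pair associated with $\mathfrak h$ is a pair $(\Gamma,\mathcal G)$ of a Hilbert space $\mathcal G$ and a bounded operator $\Gamma\colon\mathcal H^1\to\mathcal G$ such that $\mathcal H^{1,D}:=\ker\Gamma$ is dense in $\mathcal H$ and $\mathcal G^{1/2}:=\operatorname{ran}\Gamma$ is dense in $\mathcal G$. The Dirichlet operator $H^D$ is the self-adjoint operator in $\mathcal H$ associated with the closed form $\mathfrak h|_{\mathcal H^{1,D}}$; $R^D(z):=(H^D-z)^{-1}$. For $z\in\mathbb C$ let $\mathcal N^1(z):=\{h\in\mathcal H^1: \mathfrak h(h,f)=z\langle h,f\rangle_{\mathcal H}\ \forall f\in\mathcal H^{1,D}\}$. For $z\notin\sigma(H^D)$, $\Gamma$ restricts to a bijection $\mathcal N^1(z)\to\mathcal G^{1/2}$, whose inverse is denoted $S(z)\colon\mathcal G^{1/2}\to\mathcal N^1(z)\subset\mathcal H^1$. The space $\mathcal G^{1/2}$ is a Hilbert space with norm $\|\phi\|_{\mathcal G^{1/2}}:=\|S(-1)\phi\|_{\mathcal H^1}$. $C^1(z,w)$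 denotes the norm of the operator $f\mapsto f+(z-w)R^D(z)f$ as an operator $\mathcal H^1\to\mathcal H^1$. For a sesquilinear form $\mathfrak a$: $\mathfrak a^*(\phi,\psi):=\overline{\mathfrak a(\psi,\phi)}$ and $\operatorname{Im}\mathfrak a:=\frac1{2\mathrm i}(\mathfrak a-\mathfrak a^* )$; $\mathfrak a(\phi):=\mathfrak a(\phi,\phi)$. A non-negative form in $\mathcal G$ with domain $D$ is closed if $D$ is complete for the norm $(\mathfrak a(\phi)+\|\phi\|_{\mathcal G}^2)^{1/2}$. That $(-\mathfrak l_z)_z$ is a form-valued Nevanlinna function means here that it is holomorphic in $z$, symmetric, and $\operatorname{Im}(-\mathfrak l_z)\ge0$ for $\operatorname{Im}z>0$.
   Formalization: In (v) the whole interval [λ₁,λ₂], not only its endpoints, is assumed disjoint from σ(H^D); as stated (v) is false, e.g. h(f)=∫|f'|² on H¹(0,1), Γf=f(1), where l_λ(1)=−√λ tan√λ, with λ₁=1.96, λ₂=π². *)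

theory Defs
  imports "HOL-Analysis.Analysis"
begin

(* The type class complex_hilbert_space adds to a real Banach space a complex scalar
   multiplication extending the real one, and an inner product, linear in the first
   argument, that induces the given norm. *)
class complex_hilbert_space = banach +
  fixes scaleC :: "complex \<Rightarrow> 'a \<Rightarrow> 'a"  (infixr \<open>*\<^sub>C\<close> 75)
    and cinner :: "'a \<Rightarrow> 'a \<Rightarrow> complex"
  assumes scaleC_add_right: "c *\<^sub>C (x + y) = c *\<^sub>C x + c *\<^sub>C y"
    and scaleC_add_left: "(c + d) *\<^sub>C x = c *\<^sub>C x + d *\<^sub>C x"
    and scaleC_scaleC: "c *\<^sub>C (d *\<^sub>C x) = (c * d) *\<^sub>C x"
    and scaleC_of_real: "complex_of_real r *\<^sub>C x = r *\<^sub>R x"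
    and cinner_commute: "cinner x y = cnj (cinner y x)"
    and cinner_add_left: "cinner (x + y) u = cinner x u + cinner y u"
    and cinner_scaleC_left: "cinner (c *\<^sub>C x) y = c * cinner x y"
    and cinner_self: "cinner x x = complex_of_real ((norm x)\<^sup>2)"

instantiation complex :: complex_hilbert_space
begin

definition scaleC_complex :: "complex \<Rightarrow> complex \<Rightarrow> complex"
  where "scaleC_complex c x = c * x"

definition cinner_complex :: "complex \<Rightarrow> complex \<Rightarrow> complex"
  where "cinner_complex x y = x * cnj y"

instance
proof
  fix c d x y u :: complex and r :: real
  show "c *\<^sub>C (x + y) = c *\<^sub>C x + c *\<^sub>C y"
    by (simp add: scaleC_complex_def distrib_left)
  show "(c + d) *\<^sub>C x = c *\<^sub>C x + d *\<^sub>C x"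
    by (simp add: scaleC_complex_def distrib_right)
  show "c *\<^sub>C (d *\<^sub>C x) = (c * d) *\<^sub>C x"
    by (simp add: scaleC_complex_def)
  show "complex_of_real r *\<^sub>C x = r *\<^sub>R x"
    by (simp add: scaleC_complex_def scaleR_conv_of_real)
  show "cinner x y = cnj (cinner y x)"
    by (simp add: cinner_complex_def)
  show "cinner (x + y) u = cinner x u + cinner y u"
    by (simp add: cinner_complex_def distrib_right)
  show "cinner (c *\<^sub>C x) y = c * cinner x y"
    by (simp add: cinner_complex_def scaleC_complex_def)
  show "cinner x x = complex_of_real ((norm x)\<^sup>2)"
    unfolding cinner_complex_def by (rule complex_norm_square [symmetric])
qed

end


subsection \<open>Linear maps and forms on a subspace\<close>

definition csubspace :: "'a::complex_hilbert_space set \<Rightarrow> bool"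
  where "csubspace D \<longleftrightarrow>
    0 \<in> D \<and> (\<forall>x\<in>D. \<forall>y\<in>D. x + y \<in> D) \<and> (\<forall>c. \<forall>x\<in>D. c *\<^sub>C x \<in> D)"

definition clinear_on ::
    "'a::complex_hilbert_space set \<Rightarrow> ('a \<Rightarrow> 'b::complex_hilbert_space) \<Rightarrow> bool"
  where "clinear_on D T \<longleftrightarrow>
    (\<forall>x\<in>D. \<forall>y\<in>D. T (x + y) = T x + T y) \<and> (\<forall>c. \<forall>x\<in>D. T (c *\<^sub>C x) = c *\<^sub>C T x)"

(* Boundedness and operator norm of a map on D, with respect to norms nX on D and nY on the
   target that need not be the norms of the ambient types; cf. onorm. *)
definition bounded_map_on ::
    "'a set \<Rightarrow> ('a \<Rightarrow> real) \<Rightarrow> ('b \<Rightarrow> real) \<Rightarrow> ('a \<Rightarrow> 'b) \<Rightarrow> bool"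
  where "bounded_map_on D nX nY T \<longleftrightarrow> (\<exists>C. \<forall>x\<in>D. nY (T x) \<le> C * nX x)"

definition onorm_on ::
    "'a set \<Rightarrow> ('a \<Rightarrow> real) \<Rightarrow> ('b \<Rightarrow> real) \<Rightarrow> ('a \<Rightarrow> 'b) \<Rightarrow> real"
  where "onorm_on D nX nY T = (SUP x\<in>D. nY (T x) / nX x)"

definition sesquilinear_on ::
    "'a::complex_hilbert_space set \<Rightarrow> ('a \<Rightarrow> 'a \<Rightarrow> complex) \<Rightarrow> bool"
  where "sesquilinear_on D a \<longleftrightarrow> csubspace D \<and>
    (\<forall>x\<in>D. \<forall>y\<in>D. \<forall>u\<in>D. a (x + y) u = a x u + a y u \<and> a u (x + y) = a u x + a u y) \<and>
    (\<forall>c. \<forall>x\<in>D. \<forall>y\<in>D. a (c *\<^sub>C x) y = c * a x y \<and> a x (c *\<^sub>C y) = cnj c * a x y)"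

definition bounded_form_on ::
    "'a set \<Rightarrow> ('a \<Rightarrow> real) \<Rightarrow> ('a \<Rightarrow> 'a \<Rightarrow> complex) \<Rightarrow> bool"
  where "bounded_form_on D n a \<longleftrightarrow> (\<exists>C. \<forall>x\<in>D. \<forall>y\<in>D. cmod (a x y) \<le> C * n x * n y)"

definition form_adj :: "('a \<Rightarrow> 'a \<Rightarrow> complex) \<Rightarrow> 'a \<Rightarrow> 'a \<Rightarrow> complex"
  where "form_adj a x y = cnj (a y x)"

definition form_Im :: "('a \<Rightarrow> 'a \<Rightarrow> complex) \<Rightarrow> 'a \<Rightarrow> 'a \<Rightarrow> complex"
  where "form_Im a x y = (a x y - form_adj a x y) / (2 * \<i>)"

(* The order on complex is the one of HOL-Library.Complex_Order: 0 \<le> a x x says that a x x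
   is real and non-negative. *)
definition nonneg_form :: "'a::complex_hilbert_space set \<Rightarrow> ('a \<Rightarrow> 'a \<Rightarrow> complex) \<Rightarrow> bool"
  where "nonneg_form D a \<longleftrightarrow> sesquilinear_on D a \<and> (\<forall>x\<in>D. 0 \<le> a x x)"

(* The norm of the form domain; its square is a x x + norm x ^ 2, where a x x is real. *)
definition form_norm :: "('a::complex_hilbert_space \<Rightarrow> 'a \<Rightarrow> complex) \<Rightarrow> 'a \<Rightarrow> real"
  where "form_norm a x = sqrt (Re (a x x) + (norm x)\<^sup>2)"

definition closed_form :: "'a::complex_hilbert_space set \<Rightarrow> ('a \<Rightarrow> 'a \<Rightarrow> complex) \<Rightarrow> bool"
  where "closed_form D a \<longleftrightarrow> nonneg_form D a \<and>
    (\<forall>x :: nat \<Rightarrow> 'a.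
      range x \<subseteq> D \<and> (\<forall>e>0. \<exists>N. \<forall>m\<ge>N. \<forall>n\<ge>N. form_norm a (x m - x n) < e) \<longrightarrow>
      (\<exists>u\<in>D. (\<lambda>n. form_norm a (x n - u)) \<longlonglongrightarrow> 0))"


subsection \<open>Operator associated with a form, spectrum, resolvent\<close>

(* An unbounded operator is given by its domain and a function that matters on it only. *)

definition form_op_dom ::
    "'a::complex_hilbert_space set \<Rightarrow> ('a \<Rightarrow> 'a \<Rightarrow> complex) \<Rightarrow> 'a set"
  where "form_op_dom D a = {u \<in> D. \<exists>v. \<forall>f\<in>D. a u f = cinner v f}"

(* v is unique if D is dense. *)
definition form_op ::
    "'a::complex_hilbert_space set \<Rightarrow> ('a \<Rightarrow> 'a \<Rightarrow> complex) \<Rightarrow> 'a \<Rightarrow> 'a"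
  where "form_op D a u = (THE v. \<forall>f\<in>D. a u f = cinner v f)"

definition op_spectrum :: "'a::complex_hilbert_space set \<Rightarrow> ('a \<Rightarrow> 'a) \<Rightarrow> complex set"
  where "op_spectrum A T = {z. \<not> (bij_betw (\<lambda>u. T u - z *\<^sub>C u) A UNIV \<and>
    bounded_map_on UNIV norm norm (the_inv_into A (\<lambda>u. T u - z *\<^sub>C u)))}"

definition op_resolvent ::
    "'a::complex_hilbert_space set \<Rightarrow> ('a \<Rightarrow> 'a) \<Rightarrow> complex \<Rightarrow> 'a \<Rightarrow> 'a"
  where "op_resolvent A T z = the_inv_into A (\<lambda>u. T u - z *\<^sub>C u)"


subsection \<open>Boundary pairs\<close>

(* Throughout, H1 is the domain of the form h, and \<Gamma> is the boundary operator, which matters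
   on H1 only; its target is the whole type 'g, and \<Gamma> ` H1 is the boundary space of order 1/2. *)

definition ker_on :: "'a set \<Rightarrow> ('a \<Rightarrow> 'b::zero) \<Rightarrow> 'a set"
  where "ker_on D T = {x \<in> D. T x = 0}"

definition boundary_pair ::
    "'h::complex_hilbert_space set \<Rightarrow> ('h \<Rightarrow> 'h \<Rightarrow> complex)
      \<Rightarrow> ('h \<Rightarrow> 'g::complex_hilbert_space) \<Rightarrow> bool"
  where "boundary_pair H1 h \<Gamma> \<longleftrightarrow>
    closed_form H1 h \<and> closure H1 = UNIV \<and>
    clinear_on H1 \<Gamma> \<and> bounded_map_on H1 (form_norm h) norm \<Gamma> \<and>
    closure (ker_on H1 \<Gamma>) = UNIV \<and> closure (\<Gamma> ` H1) = UNIV"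

definition dir_spectrum ::
    "'h::complex_hilbert_space set \<Rightarrow> ('h \<Rightarrow> 'h \<Rightarrow> complex)
      \<Rightarrow> ('h \<Rightarrow> 'g::complex_hilbert_space) \<Rightarrow> complex set"
  where "dir_spectrum H1 h \<Gamma> =
    op_spectrum (form_op_dom (ker_on H1 \<Gamma>) h) (form_op (ker_on H1 \<Gamma>) h)"

definition dir_resolvent ::
    "'h::complex_hilbert_space set \<Rightarrow> ('h \<Rightarrow> 'h \<Rightarrow> complex)
      \<Rightarrow> ('h \<Rightarrow> 'g::complex_hilbert_space) \<Rightarrow> complex \<Rightarrow> 'h \<Rightarrow> 'h"
  where "dir_resolvent H1 h \<Gamma> z =
    op_resolvent (form_op_dom (ker_on H1 \<Gamma>) h) (form_op (ker_on H1 \<Gamma>) h) z"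

definition weak_solutions ::
    "'h::complex_hilbert_space set \<Rightarrow> ('h \<Rightarrow> 'h \<Rightarrow> complex)
      \<Rightarrow> ('h \<Rightarrow> 'g::complex_hilbert_space) \<Rightarrow> complex \<Rightarrow> 'h set"
  where "weak_solutions H1 h \<Gamma> z = {u \<in> H1. \<forall>f\<in>ker_on H1 \<Gamma>. h u f = z * cinner u f}"

(* The inverse S(z) of \<Gamma> : weak_solutions H1 h \<Gamma> z \<rightarrow> \<Gamma> ` H1; meaningful for z outside
   dir_spectrum H1 h \<Gamma>, where this restriction of \<Gamma> is bijective. *)
definition dir_solution ::
    "'h::complex_hilbert_space set \<Rightarrow> ('h \<Rightarrow> 'h \<Rightarrow> complex)
      \<Rightarrow> ('h \<Rightarrow> 'g::complex_hilbert_space) \<Rightarrow> complex \<Rightarrow> 'g \<Rightarrow> 'h"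
  where "dir_solution H1 h \<Gamma> z = the_inv_into (weak_solutions H1 h \<Gamma> z) \<Gamma>"

definition half_norm ::
    "'h::complex_hilbert_space set \<Rightarrow> ('h \<Rightarrow> 'h \<Rightarrow> complex)
      \<Rightarrow> ('h \<Rightarrow> 'g::complex_hilbert_space) \<Rightarrow> 'g \<Rightarrow> real"
  where "half_norm H1 h \<Gamma> \<phi> = form_norm h (dir_solution H1 h \<Gamma> (-1) \<phi>)"

definition C1_op ::
    "'h::complex_hilbert_space set \<Rightarrow> ('h \<Rightarrow> 'h \<Rightarrow> complex)
      \<Rightarrow> ('h \<Rightarrow> 'g::complex_hilbert_space) \<Rightarrow> complex \<Rightarrow> complex \<Rightarrow> 'h \<Rightarrow> 'h"
  where "C1_op H1 h \<Gamma> z w f = f + (z - w) *\<^sub>C dir_resolvent H1 h \<Gamma> z f"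

definition C1_norm ::
    "'h::complex_hilbert_space set \<Rightarrow> ('h \<Rightarrow> 'h \<Rightarrow> complex)
      \<Rightarrow> ('h \<Rightarrow> 'g::complex_hilbert_space) \<Rightarrow> complex \<Rightarrow> complex \<Rightarrow> real"
  where "C1_norm H1 h \<Gamma> z w = onorm_on H1 (form_norm h) (form_norm h) (C1_op H1 h \<Gamma> z w)"

definition shifted_form ::
    "('h::complex_hilbert_space \<Rightarrow> 'h \<Rightarrow> complex) \<Rightarrow> complex \<Rightarrow> 'h \<Rightarrow> 'h \<Rightarrow> complex"
  where "shifted_form h z u v = h u v - z * cinner u v"

(* The form l_z: the description operator yields the intended value once the right-hand side is
   independent of the choice of g. *)
definition dtn_form ::
    "'h::complex_hilbert_space set \<Rightarrow> ('h \<Rightarrow> 'h \<Rightarrow> complex)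
      \<Rightarrow> ('h \<Rightarrow> 'g::complex_hilbert_space) \<Rightarrow> complex \<Rightarrow> 'g \<Rightarrow> 'g \<Rightarrow> complex"
  where "dtn_form H1 h \<Gamma> z \<phi> \<psi> =
    (THE c. \<exists>g\<in>H1. \<Gamma> g = \<psi> \<and> c = shifted_form h z (dir_solution H1 h \<Gamma> z \<phi>) g)"

definition L_bound ::
    "'h::complex_hilbert_space set \<Rightarrow> ('h \<Rightarrow> 'h \<Rightarrow> complex)
      \<Rightarrow> ('h \<Rightarrow> 'g::complex_hilbert_space) \<Rightarrow> complex \<Rightarrow> real"
  where "L_bound H1 h \<Gamma> z =
    1 + cmod (z + 1) * onorm_on (\<Gamma> ` H1) (half_norm H1 h \<Gamma>) (form_norm h) (dir_solution H1 h \<Gamma> z)"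

definition nevanlinna_form_family ::
    "complex set \<Rightarrow> 'a::complex_hilbert_space set \<Rightarrow> (complex \<Rightarrow> 'a \<Rightarrow> 'a \<Rightarrow> complex) \<Rightarrow> bool"
  where "nevanlinna_form_family U D a \<longleftrightarrow>
    (\<forall>z\<in>U. sesquilinear_on D (a z)) \<and>
    (\<forall>\<phi>\<in>D. \<forall>\<psi>\<in>D. (\<lambda>z. a z \<phi> \<psi>) holomorphic_on U) \<and>
    (\<forall>z\<in>U. \<forall>\<phi>\<in>D. \<forall>\<psi>\<in>D. form_adj (a z) \<phi> \<psi> = a (cnj z) \<phi> \<psi>) \<and>
    (\<forall>z\<in>U. 0 < Im z \<longrightarrow> (\<forall>\<phi>\<in>D. 0 \<le> form_Im (a z) \<phi> \<phi>))"

end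

theory Submission
  imports Defs
begin

text \<open>Everything about the Dirichlet operator is read off the weak equation \<open>h(u, k) -
  z \<langle>u, k\<rangle> = \<langle>f, k\<rangle>\<close> for \<open>k\<close> in \<open>ker
  \<Gamma>\<close>. The Riesz representation in the form domain solves it for \<open>z =
  -1\<close> and produces \<open>S(-1)\<close>; then \<open>S(z) = S(w) + (z - w) R(z)
  S(w)\<close> gives the solution operator for all \<open>z\<close> outside the spectrum. The
  spectrum is symmetric under conjugation, so in \<open>l\<^sub>z(\<phi>, \<psi>)\<close> one may
  choose \<open>S(cnj w)\<psi>\<close> as the extension of \<open>\<psi>\<close>, which yields the
  difference formula (ii). Inserting the Neumann series of \<open>S(\<zeta>)\<phi>\<close> around
  \<open>z\<close> into (ii) expands \<open>l\<^sub>\<zeta>(\<phi>, \<psi>)\<close> in a power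
  series, from which holomorphy and all derivatives are read off; monotonicity follows from the
  sign of the first derivative. Closedness for \<open>\<mu> < 0\<close> holds because
  \<open>S(\<mu>)\<close> minimises \<open>h - \<mu>\<close> among all extensions, so that
  \<open>l\<^sub>\<mu>\<close> is controlled by the form norm from both sides.\<close>

section \<open>Inner products and non-negative forms\<close>

lemma scaleC_1 [simp]: "1 *\<^sub>C x = (x :: 'a::complex_hilbert_space)"
  using scaleC_of_real [of 1 x] by simp

lemma scaleC_zero_left [simp]: "0 *\<^sub>C x = (0 :: 'a::complex_hilbert_space)"
  using scaleC_of_real [of 0 x] by simp

lemma scaleC_minus1 [simp]: "(-1) *\<^sub>C x = - (x :: 'a::complex_hilbert_space)"
  using scaleC_of_real [of "-1" x] by simp

lemma scaleC_zero_right [simp]: "c *\<^sub>C (0 :: 'a::complex_hilbert_space) = 0"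
  using scaleC_add_right [of c 0 0] by simp

lemma scaleC_diff_left: "(c - d) *\<^sub>C x = c *\<^sub>C x - d *\<^sub>C (x :: 'a::complex_hilbert_space)"
  using scaleC_add_left [of "c - d" d x] by (simp add: algebra_simps)

lemma scaleC_diff_right: "c *\<^sub>C (x - y) = c *\<^sub>C x - c *\<^sub>C (y :: 'a::complex_hilbert_space)"
  using scaleC_add_right [of c "x - y" y] by (simp add: algebra_simps)

lemma cinner_add_right: "cinner x (y + u) = cinner x y + cinner x (u :: 'a::complex_hilbert_space)"
  using cinner_commute cinner_add_left complex_cnj_add by metis

lemma cinner_scaleC_right: "cinner x (c *\<^sub>C y) = cnj c * cinner x (y :: 'a::complex_hilbert_space)"
  using cinner_commute cinner_scaleC_left complex_cnj_mult by metis

lemma cinner_diff_left: "cinner (x - y) u = cinner x u - cinner y (u :: 'a::complex_hilbert_space)"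
  using cinner_add_left [of "x - y" y u] by (simp add: algebra_simps)

lemma cinner_diff_right: "cinner u (x - y) = cinner u x - cinner u (y :: 'a::complex_hilbert_space)"
  using cinner_add_right [of u "x - y" y] by (simp add: algebra_simps)

lemma cinner_zero_left [simp]: "cinner 0 (x :: 'a::complex_hilbert_space) = 0"
  using cinner_diff_left [of x x x] by simp

lemma cinner_zero_right [simp]: "cinner (x :: 'a::complex_hilbert_space) 0 = 0"
  using cinner_diff_right [of x x x] by simp

lemmas cinner_simps = cinner_add_left cinner_add_right cinner_diff_left cinner_diff_right
  cinner_scaleC_left cinner_scaleC_right

lemma csubspace_scaleC: "csubspace D \<Longrightarrow> x \<in> D \<Longrightarrow> c *\<^sub>C x \<in> D"
  by (simp add: csubspace_def)

lemma csubspace_add: "csubspace D \<Longrightarrow> x \<in> D \<Longrightarrow> y \<in> D \<Longrightarrow> x + y \<in> D"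
  by (simp add: csubspace_def)

lemma csubspace_0: "csubspace D \<Longrightarrow> 0 \<in> D"
  by (simp add: csubspace_def)

lemma csubspace_diff: "csubspace D \<Longrightarrow> x \<in> D \<Longrightarrow> y \<in> D \<Longrightarrow> x - y \<in> D"
  using csubspace_add [of D x "(-1) *\<^sub>C y"] csubspace_scaleC [of D y "-1"] by simp

lemma csubspace_UNIV: "csubspace UNIV"
  by (simp add: csubspace_def)

section \<open>Calculus of sesquilinear forms on a subspace\<close>

context
  fixes D :: "'a::complex_hilbert_space set" and a
  assumes a: "sesquilinear_on D a"
begin

lemma sesquilinear_csubspace: "csubspace D"
  using a by (simp add: sesquilinear_on_def)

lemma sesquilinear_add_left: "x \<in> D \<Longrightarrow> y \<in> D \<Longrightarrow> u \<in> D \<Longrightarrow> a (x + y) u = a x u + a y u"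
  using a by (simp add: sesquilinear_on_def)

lemma sesquilinear_add_right: "x \<in> D \<Longrightarrow> y \<in> D \<Longrightarrow> u \<in> D \<Longrightarrow> a u (x + y) = a u x + a u y"
  using a by (simp add: sesquilinear_on_def)

lemma sesquilinear_scaleC_left: "x \<in> D \<Longrightarrow> y \<in> D \<Longrightarrow> a (c *\<^sub>C x) y = c * a x y"
  using a by (simp add: sesquilinear_on_def)

lemma sesquilinear_scaleC_right: "x \<in> D \<Longrightarrow> y \<in> D \<Longrightarrow> a x (c *\<^sub>C y) = cnj c * a x y"
  using a by (simp add: sesquilinear_on_def)

lemma sesquilinear_diff_left: "x \<in> D \<Longrightarrow> y \<in> D \<Longrightarrow> u \<in> D \<Longrightarrow> a (x - y) u = a x u - a y u"
  using sesquilinear_add_left [of "x - y" y u] csubspace_diff [OF sesquilinear_csubspace]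
  by (simp add: algebra_simps)

lemma sesquilinear_diff_right: "x \<in> D \<Longrightarrow> y \<in> D \<Longrightarrow> u \<in> D \<Longrightarrow> a u (x - y) = a u x - a u y"
  using sesquilinear_add_right [of "x - y" y u] csubspace_diff [OF sesquilinear_csubspace]
  by (simp add: algebra_simps)

lemma sesquilinear_shifted_form: "sesquilinear_on D (shifted_form a z)"
  using a by (simp add: sesquilinear_on_def shifted_form_def cinner_simps algebra_simps)

end

lemmas sesquilinear_simps = sesquilinear_add_left sesquilinear_add_right sesquilinear_scaleC_left
  sesquilinear_scaleC_right sesquilinear_diff_left sesquilinear_diff_right

lemma sesquilinear_mono: "sesquilinear_on E a \<Longrightarrow> csubspace D \<Longrightarrow> D \<subseteq> E \<Longrightarrow> sesquilinear_on D a"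
  unfolding sesquilinear_on_def by blast

lemma null_comparison: "(\<And>n. norm (f n) \<le> g n) \<Longrightarrow> (g \<longlongrightarrow> 0) F \<Longrightarrow> (f \<longlongrightarrow> 0) F"
  by (rule Lim_null_comparison [OF always_eventually, of _ g]) simp_all

text \<open>This discriminant criterion serves twice: for the Cauchy-Schwarz inequality and for the
  Euler-Lagrange step of the Riesz argument. \<open>C = 0\<close> is allowed, so degenerate forms
  are covered.\<close>

lemma discriminant_nonpos:
  fixes A B C :: real
  assumes nn: "\<And>t. 0 \<le> A + 2 * t * B + t\<^sup>2 * C" and C: "0 \<le> C"
  shows "B\<^sup>2 \<le> A * C"
proof (cases "C = 0")
  case True
  have "B = 0"
  proof (rule ccontr)
    assume "B \<noteq> 0"
    \<comment> \<open>The point where the affine function \<open>A + 2 * t * B\<close> takes the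
      value -1.\<close>
    with nn [of "- (A + 1) / (2 * B)"] True show False by (simp add: field_simps)
  qed
  with True show ?thesis by simp
next
  case False
  with C have "C > 0" by simp
  have "0 \<le> A - B\<^sup>2 / C"
    using nn [of "- B / C"] \<open>C > 0\<close> by (simp add: field_simps power2_eq_square)
  with \<open>C > 0\<close> show ?thesis by (simp add: field_simps)
qed

text \<open>Polarisation: a real diagonal at \<open>x + y\<close> relates the imaginary parts of
  \<open>a x y\<close> and \<open>a y x\<close>, and at \<open>x + \<i> *\<^sub>C y\<close> the real
  parts. Symmetry therefore need not be postulated.\<close>

lemma nonneg_form_hermitian:
  assumes "nonneg_form D a" "x \<in> D" "y \<in> D"
  shows "a y x = cnj (a x y)"
proof -
  have s: "sesquilinear_on D a" and nn: "\<And>u. u \<in> D \<Longrightarrow> Im (a u u) = 0"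
    using assms(1) by (auto simp: nonneg_form_def less_eq_complex_def)
  note sub = sesquilinear_csubspace [OF s]
  have "Im (a (x + y) (x + y)) = 0" "Im (a (x + \<i> *\<^sub>C y) (x + \<i> *\<^sub>C y)) = 0"
    using assms by (auto intro!: nn csubspace_add csubspace_scaleC sub)
  with assms nn [of x] nn [of y] show ?thesis
    by (simp add: sesquilinear_simps [OF s] csubspace_add csubspace_scaleC sub complex_eq_iff)
qed

lemma nonneg_form_add_scaled:
  assumes "nonneg_form D a" "x \<in> D" "y \<in> D"
  shows "Re (a (x + complex_of_real t *\<^sub>C y) (x + complex_of_real t *\<^sub>C y))
    = Re (a x x) + 2 * t * Re (a x y) + t\<^sup>2 * Re (a y y)"
proof -
  have s: "sesquilinear_on D a" using assms(1) by (simp add: nonneg_form_def)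
  have "complex_of_real t *\<^sub>C y \<in> D"
    using assms by (auto intro!: csubspace_scaleC sesquilinear_csubspace [OF s])
  with assms show ?thesis
    using nonneg_form_hermitian [OF assms]
    by (simp add: sesquilinear_simps [OF s] csubspace_add [OF sesquilinear_csubspace [OF s]]
        power2_eq_square algebra_simps)
qed

text \<open>The phase of \<open>v\<close>; rotating the second argument of a form by it makes the
  value real and equal to its modulus.\<close>

lemma ex_unimodular: "\<exists>c. cmod c = 1 \<and> cnj c * v = complex_of_real (cmod v)"
proof (cases "v = 0")
  case True then show ?thesis by (intro exI [of _ 1]) simp
next
  case False
  then show ?thesis
    by (intro exI [of _ "v / complex_of_real (cmod v)"])
      (simp add: norm_divide complex_norm_square [symmetric] power2_eq_square divide_simps mult.commute
        flip: complex_norm_square)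
qed

lemma nonneg_form_Re_nonneg: "nonneg_form D a \<Longrightarrow> x \<in> D \<Longrightarrow> 0 \<le> Re (a x x)"
  by (auto simp: nonneg_form_def less_eq_complex_def)

lemma nonneg_form_Cauchy_Schwarz:
  assumes "nonneg_form D a" "x \<in> D" "y \<in> D"
  shows "cmod (a x y) \<le> sqrt (Re (a x x)) * sqrt (Re (a y y))"
proof -
  have s: "sesquilinear_on D a" using assms(1) by (simp add: nonneg_form_def)
  obtain c where c: "cmod c = 1" "cnj c * a x y = complex_of_real (cmod (a x y))"
    using ex_unimodular by blast
  have cy: "c *\<^sub>C y \<in> D" using assms by (auto intro!: csubspace_scaleC sesquilinear_csubspace [OF s])
  have "cnj c * c = 1" using c(1) complex_norm_square [of c] by (simp add: mult.commute)
  then have e: "a x (c *\<^sub>C y) = complex_of_real (cmod (a x y))" "a (c *\<^sub>C y) (c *\<^sub>C y) = a y y"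
    using assms c cy
    by (simp_all add: sesquilinear_simps [OF s] flip: mult.assoc)
  have "0 \<le> Re (a x x) + 2 * t * cmod (a x y) + t\<^sup>2 * Re (a y y)" for t
  proof -
    have "x + complex_of_real t *\<^sub>C c *\<^sub>C y \<in> D"
      using assms cy
      by (auto intro!: csubspace_scaleC csubspace_add sesquilinear_csubspace [OF s])
    from nonneg_form_Re_nonneg [OF assms(1) this] show ?thesis
      using nonneg_form_add_scaled [OF assms(1,2) cy, of t] by (simp add: e)
  qed
  then have "(cmod (a x y))\<^sup>2 \<le> Re (a x x) * Re (a y y)"
    by (rule discriminant_nonpos) (rule nonneg_form_Re_nonneg [OF assms(1,3)])
  then show ?thesis
    by (simp add: real_le_rsqrt flip: real_sqrt_mult)
qed

lemma nonneg_form_cinner: "nonneg_form UNIV cinner"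
  by (simp add: nonneg_form_def sesquilinear_on_def csubspace_UNIV cinner_simps cinner_self
      less_eq_complex_def)

lemma cinner_Cauchy_Schwarz: "cmod (cinner x y) \<le> norm x * norm (y :: 'a::complex_hilbert_space)"
  using nonneg_form_Cauchy_Schwarz [OF nonneg_form_cinner, of x y] by (simp add: cinner_self)

text \<open>The class gives homogeneity of the norm for real scalars only; the complex case comes
  from the inner product.\<close>

lemma norm_scaleC: "norm (c *\<^sub>C x) = cmod c * norm (x :: 'a::complex_hilbert_space)"
proof -
  have "complex_of_real ((norm (c *\<^sub>C x))\<^sup>2) = cinner (c *\<^sub>C x) (c *\<^sub>C x)"
    by (simp only: cinner_self)
  also have "\<dots> = c * cnj c * cinner x x"
    by (simp add: cinner_simps)
  also have "\<dots> = complex_of_real ((cmod c * norm x)\<^sup>2)"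
    by (simp only: cinner_self complex_norm_square [symmetric] power_mult_distrib of_real_mult)
  finally have "complex_of_real ((norm (c *\<^sub>C x))\<^sup>2) = complex_of_real ((cmod c * norm x)\<^sup>2)" .
  then have "(norm (c *\<^sub>C x))\<^sup>2 = (cmod c * norm x)\<^sup>2"
    by (simp only: of_real_eq_iff)
  then show ?thesis by simp
qed

lemma tendsto_cinner_left:
  assumes "(x \<longlongrightarrow> u) F"
  shows "((\<lambda>n. cinner (x n) v) \<longlongrightarrow> cinner u (v :: 'a::complex_hilbert_space)) F"
proof -
  have "((\<lambda>n. norm (x n - u) * norm v) \<longlongrightarrow> 0 * norm v) F"
    by (intro tendsto_mult tendsto_const) (use assms in \<open>simp add: LIM_zero tendsto_norm_zero\<close>)
  then have "((\<lambda>n. cinner (x n) v - cinner u v) \<longlongrightarrow> 0) F"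
    by (intro null_comparison [of "\<lambda>n. cinner (x n) v - cinner u v"])
      (simp_all add: cinner_Cauchy_Schwarz flip: cinner_diff_left)
  then show ?thesis by (simp add: LIM_zero_iff)
qed

text \<open>Approximating \<open>v\<close> itself by elements of \<open>D\<close> turns the
  vanishing inner products into \<open>cinner v v = 0\<close>.\<close>

lemma cinner_dense_eq_0:
  assumes D: "closure D = (UNIV :: 'a::complex_hilbert_space set)" and 0: "\<And>f. f \<in> D \<Longrightarrow> cinner v f = 0"
  shows "v = 0"
proof -
  obtain x where x: "\<And>n. x n \<in> D" "x \<longlonglongrightarrow> v"
    using D closure_sequential [of v D] by auto
  have "(\<lambda>n. cinner (x n) v) \<longlonglongrightarrow> cinner v v"
    by (rule tendsto_cinner_left) (rule x)
  moreover have "cinner (x n) v = 0" for n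
    using 0 [OF x(1)] cinner_commute [of "x n" v] by simp
  ultimately have "cinner v v = 0"
    by (simp add: LIMSEQ_const_iff)
  then show ?thesis by (simp add: cinner_self)
qed

section \<open>Closed forms and the Riesz representation\<close>

text \<open>\<open>shifted_form a (-1)\<close> is \<open>a\<close> plus the inner product, that is,
  the inner product of the form domain, which induces \<open>form_norm a\<close>.\<close>

lemma nonneg_shifted_form:
  assumes "nonneg_form D a"
  shows "nonneg_form D (shifted_form a (-1))"
  using assms by (auto simp: nonneg_form_def sesquilinear_shifted_form shifted_form_def
      cinner_self less_eq_complex_def)

lemma form_norm_sqrt: "form_norm a x = sqrt (Re (shifted_form a (-1) x x))"
  by (simp add: form_norm_def shifted_form_def cinner_self)

section \<open>The norm of the form domain\<close>

context
  fixes D :: "'a::complex_hilbert_space set" and a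
  assumes nn: "nonneg_form D a"
begin

lemma form_norm_power2: "x \<in> D \<Longrightarrow> (form_norm a x)\<^sup>2 = Re (a x x) + (norm x)\<^sup>2"
  using nonneg_form_Re_nonneg [OF nn, of x] by (simp add: form_norm_def)

lemma form_norm_nonneg: "x \<in> D \<Longrightarrow> 0 \<le> form_norm a x"
  using nonneg_form_Re_nonneg [OF nn, of x] by (simp add: form_norm_def)

lemma norm_le_form_norm: "x \<in> D \<Longrightarrow> norm x \<le> form_norm a x"
  using nonneg_form_Re_nonneg [OF nn, of x] by (simp add: form_norm_def real_le_rsqrt)

lemma shifted_form_Cauchy_Schwarz:
  "x \<in> D \<Longrightarrow> y \<in> D \<Longrightarrow> cmod (shifted_form a (-1) x y) \<le> form_norm a x * form_norm a y"
  using nonneg_form_Cauchy_Schwarz [OF nonneg_shifted_form [OF nn]] by (simp add: form_norm_sqrt)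

lemma form_norm_scaleC: "x \<in> D \<Longrightarrow> form_norm a (c *\<^sub>C x) = cmod c * form_norm a x"
proof -
  assume x: "x \<in> D"
  have s: "sesquilinear_on D a" using nn by (simp add: nonneg_form_def)
  have "a (c *\<^sub>C x) (c *\<^sub>C x) = complex_of_real ((cmod c)\<^sup>2) * a x x"
    using x by (simp add: sesquilinear_simps [OF s] csubspace_scaleC sesquilinear_csubspace [OF s]
        complex_norm_square del: of_real_power)
  then show ?thesis
    by (simp add: form_norm_def norm_scaleC power_mult_distrib Re_complex_of_real real_sqrt_mult
        flip: distrib_left of_real_power)
qed

lemma form_norm_triangle:
  assumes "x \<in> D" "y \<in> D"
  shows "form_norm a (x + y) \<le> form_norm a x + form_norm a y"
proof -
  note nn1 = nonneg_shifted_form [OF nn]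
  have mem: "x + y \<in> D"
    using nn assms csubspace_add sesquilinear_csubspace unfolding nonneg_form_def by blast
  have "(form_norm a (x + y))\<^sup>2 =
      (form_norm a x)\<^sup>2 + 2 * Re (shifted_form a (-1) x y) + (form_norm a y)\<^sup>2"
    using nonneg_form_add_scaled [OF nn1 assms, of 1] assms mem
    by (simp add: form_norm_power2 shifted_form_def cinner_self)
  also have "\<dots> \<le> (form_norm a x + form_norm a y)\<^sup>2"
    using shifted_form_Cauchy_Schwarz [OF assms] complex_Re_le_cmod [of "shifted_form a (-1) x y"]
    by (simp add: power2_sum)
  finally show ?thesis
    using assms form_norm_nonneg by (meson add_nonneg_nonneg power2_le_imp_le)
qed

end

text \<open>The minimising sequence of \<open>J x = \<parallel>x\<parallel>\<^sup>2 - 2 Re (F x)\<close> is Cauchy by the parallelogram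
  identity, and near-minimality forces \<open>(x\<^sub>n, k) \<longlonglongrightarrow> F k\<close>; so neither continuity of
  \<open>J\<close> nor its derivative is needed.\<close>

lemma closed_form_Riesz:
  assumes cf: "closed_form D a"
    and Fadd: "\<And>x y. x \<in> D \<Longrightarrow> y \<in> D \<Longrightarrow> F (x + y) = F x + F y"
    and Fscale: "\<And>c x. x \<in> D \<Longrightarrow> F (c *\<^sub>C x) = cnj c * F x"
    and Fbd: "\<And>x. x \<in> D \<Longrightarrow> cmod (F x) \<le> C * form_norm a x"
  shows "\<exists>u\<in>D. \<forall>k\<in>D. shifted_form a (-1) u k = F k"
proof -
  have nn: "nonneg_form D a" using cf by (simp add: closed_form_def)
  define b where "b = shifted_form a (-1)"
  define N where "N = form_norm a"
  define J where "J x = (N x)\<^sup>2 - 2 * Re (F x)" for x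
  have nb: "nonneg_form D b" unfolding b_def by (rule nonneg_shifted_form [OF nn])
  then have s: "sesquilinear_on D b" by (simp add: nonneg_form_def)
  note sub = sesquilinear_csubspace [OF s]
  have N2: "(N x)\<^sup>2 = Re (b x x)" if "x \<in> D" for x
    using form_norm_power2 [OF nn that] by (simp add: N_def b_def shifted_form_def cinner_self)
  have Nadd: "(N (x + complex_of_real t *\<^sub>C y))\<^sup>2 = (N x)\<^sup>2 + 2 * t * Re (b x y) + t\<^sup>2 * (N y)\<^sup>2"
    if "x \<in> D" "y \<in> D" for x y t
    using nonneg_form_add_scaled [OF nb that] that by (simp add: N2 csubspace_add csubspace_scaleC sub)
  have Jadd: "J (x + complex_of_real t *\<^sub>C y) = J x + 2 * t * Re (b x y - F y) + t\<^sup>2 * (N y)\<^sup>2"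
    if "x \<in> D" "y \<in> D" for x y t
    using that Nadd [OF that, of t]
    by (simp add: J_def Fadd Fscale csubspace_scaleC sub algebra_simps)
  \<comment> \<open>Completing the square in \<open>(N x)\<^sup>2 - 2 * C * N x\<close>.\<close>
  have "J x \<ge> - (C\<^sup>2)" if "x \<in> D" for x
  proof -
    have "Re (F x) \<le> C * N x"
      using Fbd [OF that] complex_Re_le_cmod [of "F x"] by (simp add: N_def)
    moreover have "0 \<le> (N x - C)\<^sup>2" by simp
    ultimately show ?thesis by (simp add: J_def power2_diff mult.commute)
  qed
  then have bdd: "bdd_below (J ` D)" by (auto intro!: bdd_belowI)
  define I where "I = Inf (J ` D)"
  have Ile: "I \<le> J x" if "x \<in> D" for x
    unfolding I_def using bdd that by (simp add: cInf_lower)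
  have "\<exists>x\<in>D. J x < I + 1 / (real n + 1)" for n
  proof -
    have "J ` D \<noteq> {}" using csubspace_0 [OF sub] by auto
    then have "\<exists>j\<in>J ` D. j < I + 1 / (real n + 1)"
      using bdd unfolding I_def by (subst cInf_less_iff [symmetric]) auto
    then show ?thesis by auto
  qed
  then obtain x where x: "\<And>n. x n \<in> D" "\<And>n. J (x n) < I + 1 / (real n + 1)"
    by metis
  \<comment> \<open>At the midpoint \<open>m\<close> the functional equals the mean of
    \<open>J y\<close> and \<open>J y'\<close> minus a quarter of
    \<open>(N (y - y'))\<^sup>2\<close>, and it is still at least \<open>I\<close>.\<close>
  have half: "(N (y - y'))\<^sup>2 \<le> 2 * (J y - I) + 2 * (J y' - I)" if y: "y \<in> D" "y' \<in> D" for y y'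
  proof -
    define m where "m = complex_of_real (1/2) *\<^sub>C (y + y')"
    have m: "m \<in> D" unfolding m_def using y by (simp add: csubspace_add csubspace_scaleC sub)
    have d: "y' - y \<in> D" using y by (simp add: csubspace_diff sub)
    have mm: "m = y + complex_of_real (1/2) *\<^sub>C (y' - y)"
    proof -
      have "(1/2) *\<^sub>C y + (1/2) *\<^sub>C y = y" by (simp flip: scaleC_add_left)
      then have "y - (1/2) *\<^sub>C y = (1/2) *\<^sub>C y" by (metis add_diff_cancel_left')
      then show ?thesis unfolding m_def by (simp add: scaleC_add_right scaleC_diff_right add_diff_eq
            diff_add_eq flip: add_diff_eq)
    qed
    have yy: "y' = y + complex_of_real 1 *\<^sub>C (y' - y)" by simp
    have sy: "N (y - y') = N (y' - y)"
      using form_norm_scaleC [OF nn d, of "-1"] by (simp add: N_def)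
    have "J m = J y + Re (b y (y' - y) - F (y' - y)) + (N (y' - y))\<^sup>2 / 4"
      using Jadd [OF y(1) d, of "1/2"] by (simp add: mm power2_eq_square)
    moreover have "J y' = J y + 2 * Re (b y (y' - y) - F (y' - y)) + (N (y' - y))\<^sup>2"
      using Jadd [OF y(1) d, of 1] by simp
    ultimately show ?thesis
      using Ile [OF m] unfolding sy by argo
  qed
  have cau: "\<exists>M. \<forall>m\<ge>M. \<forall>n\<ge>M. form_norm a (x m - x n) < e" if "e > 0" for e
  proof -
    obtain M where M: "4 / (real M + 1) < e\<^sup>2"
    proof -
      obtain M where "4 / e\<^sup>2 < real M" using reals_Archimedean2 by blast
      then have "4 / e\<^sup>2 < real M + 1" by simp
      then have "4 < e\<^sup>2 * (real M + 1)" using \<open>e > 0\<close> by (simp add: pos_divide_less_eq mult.commute)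
      then show thesis by (intro that) (simp add: pos_divide_less_eq)
    qed
    show ?thesis
    proof (intro exI allI impI)
      fix m n assume mn: "m \<ge> M" "n \<ge> M"
      have "1 / (real m + 1) \<le> 1 / (real M + 1)" "1 / (real n + 1) \<le> 1 / (real M + 1)"
        using mn by (auto intro!: divide_left_mono)
      then have "(N (x m - x n))\<^sup>2 < e\<^sup>2"
        using half [OF x(1) x(1), of m n] x(2) [of m] x(2) [of n] M by simp
      then show "form_norm a (x m - x n) < e"
        using that by (simp add: N_def power_less_imp_less_base)
    qed
  qed
  have "range x \<subseteq> D \<and> (\<forall>e>0. \<exists>M. \<forall>m\<ge>M. \<forall>n\<ge>M. form_norm a (x m - x n) < e)"
    using x(1) cau by blast
  then obtain u where u: "u \<in> D" "(\<lambda>n. form_norm a (x n - u)) \<longlonglongrightarrow> 0"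
    using cf unfolding closed_form_def by blast
  have Re_eq: "Re (b u k) = Re (F k)" if k: "k \<in> D" for k
  proof -
    \<comment> \<open>Along the line through \<open>x n\<close> in direction \<open>k\<close>,
      \<open>J\<close> stays above \<open>I\<close>, while \<open>J (x n)\<close> exceeds
      \<open>I\<close> by less than \<open>1 / (real n + 1)\<close>; the discriminant bounds the
      slope.\<close>
    have bd: "(Re (b (x n) k - F k))\<^sup>2 \<le> 1 / (real n + 1) * (N k)\<^sup>2" for n
    proof (rule discriminant_nonpos)
      fix t
      have "x n + complex_of_real t *\<^sub>C k \<in> D"
        using x k by (simp add: csubspace_add csubspace_scaleC sub)
      from Ile [OF this] x(2) [of n] Jadd [OF x(1) k, of n t]
      show "0 \<le> 1 / (real n + 1) + 2 * t * Re (b (x n) k - F k) + t\<^sup>2 * (N k)\<^sup>2" by linarith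
    qed simp
    have "(\<lambda>n. 1 / (real n + 1) * (N k)\<^sup>2) \<longlonglongrightarrow> 0 * (N k)\<^sup>2"
    proof (intro tendsto_mult tendsto_const)
      show "(\<lambda>n. 1 / (real n + 1)) \<longlonglongrightarrow> 0"
        using LIMSEQ_inverse_real_of_nat unfolding inverse_eq_divide of_nat_Suc add.commute [of 1] .
    qed
    then have "(\<lambda>n. (Re (b (x n) k - F k))\<^sup>2) \<longlonglongrightarrow> 0"
      using bd by (intro null_comparison [of "\<lambda>n. (Re (b (x n) k - F k))\<^sup>2"]) simp_all
    then have 1: "(\<lambda>n. Re (b (x n) k - F k)) \<longlonglongrightarrow> 0"
      by simp
    have "(\<lambda>n. form_norm a (x n - u) * N k) \<longlonglongrightarrow> 0 * N k"
      by (intro tendsto_mult tendsto_const u)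
    moreover have "norm (b (x n - u) k) \<le> form_norm a (x n - u) * N k" for n
      using shifted_form_Cauchy_Schwarz [OF nn, of "x n - u" k] x u k
      by (simp add: b_def N_def csubspace_diff sub)
    ultimately have "(\<lambda>n. b (x n - u) k) \<longlonglongrightarrow> 0"
      by (intro null_comparison [of "\<lambda>n. b (x n - u) k"]) simp_all
    then have "(\<lambda>n. Re (b (x n - u) k)) \<longlonglongrightarrow> 0" using tendsto_Re by fastforce
    then have "(\<lambda>n. Re (b (x n) k - F k) - Re (b (x n - u) k)) \<longlonglongrightarrow> 0 - 0"
      by (intro tendsto_diff 1)
    moreover have "Re (b (x n) k - F k) - Re (b (x n - u) k) = Re (b u k) - Re (F k)" for n
      using x u k by (simp add: sesquilinear_simps [OF s])
    ultimately have "(\<lambda>n::nat. Re (b u k) - Re (F k)) \<longlonglongrightarrow> 0 - 0" by (simp only:)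
    then show ?thesis unfolding LIMSEQ_const_iff by simp
  qed
  \<comment> \<open>Real parts at \<open>\<i> *\<^sub>C k\<close> are imaginary parts at
    \<open>k\<close>, since both sides are conjugate-linear in \<open>k\<close>.\<close>
  have "b u k = F k" if k: "k \<in> D" for k
    using Re_eq [OF k] Re_eq [OF csubspace_scaleC [OF sub k, of \<i>]] k u
    by (simp add: sesquilinear_simps [OF s] Fscale complex_eq_iff)
  with u show ?thesis unfolding b_def by blast
qed

text \<open>The zero form has the ambient norm as its form norm, so its closedness is completeness
  of the space. The result supplies the adjoint of a resolvent below.\<close>

lemma cinner_Riesz:
  fixes F :: "'a::complex_hilbert_space \<Rightarrow> complex"
  assumes "\<And>x y. F (x + y) = F x + F y" "\<And>c x. F (c *\<^sub>C x) = cnj c * F x"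
    and "\<And>x. cmod (F x) \<le> C * norm x"
  shows "\<exists>u. \<forall>k. cinner u k = F k"
proof -
  have n: "form_norm (\<lambda>_ _. 0) = (norm :: 'a \<Rightarrow> real)"
    by (simp add: form_norm_def fun_eq_iff)
  have "closed_form (UNIV :: 'a set) (\<lambda>_ _. 0)"
    unfolding closed_form_def
  proof (intro conjI allI impI)
    show "nonneg_form (UNIV :: 'a set) (\<lambda>_ _. 0)"
      by (simp add: nonneg_form_def sesquilinear_on_def csubspace_UNIV)
    fix x :: "nat \<Rightarrow> 'a"
    assume "range x \<subseteq> UNIV \<and> (\<forall>e>0. \<exists>N. \<forall>m\<ge>N. \<forall>n\<ge>N. form_norm (\<lambda>_ _. 0) (x m - x n) < e)"
    then have "Cauchy x" by (simp add: n Cauchy_def dist_norm)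
    then obtain u where "x \<longlonglongrightarrow> u" using Cauchy_convergent convergent_def by blast
    then show "\<exists>u\<in>UNIV. (\<lambda>n. form_norm (\<lambda>_ _. 0) (x n - u)) \<longlonglongrightarrow> 0"
      unfolding n by (intro bexI [of _ u] tendsto_norm_zero LIM_zero) auto
  qed
  from closed_form_Riesz [OF this, of F C] show ?thesis
    using assms by (simp add: n shifted_form_def)
qed

section \<open>The Dirichlet operator\<close>

locale boundary_setting =
  fixes H1 :: "'h::complex_hilbert_space set"
    and h :: "'h \<Rightarrow> 'h \<Rightarrow> complex"
    and \<Gamma> :: "'h \<Rightarrow> 'g::complex_hilbert_space"
  assumes bp: "boundary_pair H1 h \<Gamma>"
begin

abbreviation "D \<equiv> ker_on H1 \<Gamma>"
abbreviation "\<Sigma> \<equiv> dir_spectrum H1 h \<Gamma>"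
abbreviation "R \<equiv> dir_resolvent H1 h \<Gamma>"
abbreviation "S \<equiv> dir_solution H1 h \<Gamma>"
abbreviation "\<L> \<equiv> dtn_form H1 h \<Gamma>"
abbreviation "nrm \<equiv> form_norm h"
abbreviation "hnrm \<equiv> half_norm H1 h \<Gamma>"

lemma h_nonneg_form: "nonneg_form H1 h" and h_closed_form: "closed_form H1 h"
  using bp by (auto simp: boundary_pair_def closed_form_def)

lemma h_sesquilinear: "sesquilinear_on H1 h" using h_nonneg_form by (simp add: nonneg_form_def)

lemmas h_simps = sesquilinear_simps [OF h_sesquilinear]

lemma csubspace_H1: "csubspace H1" by (rule sesquilinear_csubspace [OF h_sesquilinear])

lemmas H1_intros = csubspace_add [OF csubspace_H1] csubspace_diff [OF csubspace_H1] csubspace_scaleC [OF csubspace_H1]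
  csubspace_0 [OF csubspace_H1]

lemma hermitian: "x \<in> H1 \<Longrightarrow> y \<in> H1 \<Longrightarrow> h y x = cnj (h x y)"
  by (rule nonneg_form_hermitian [OF h_nonneg_form])

lemma \<Gamma>_add: "x \<in> H1 \<Longrightarrow> y \<in> H1 \<Longrightarrow> \<Gamma> (x + y) = \<Gamma> x + \<Gamma> y"
  and \<Gamma>_scaleC: "x \<in> H1 \<Longrightarrow> \<Gamma> (c *\<^sub>C x) = c *\<^sub>C \<Gamma> x"
  using bp by (auto simp: boundary_pair_def clinear_on_def)

lemma \<Gamma>_diff: "x \<in> H1 \<Longrightarrow> y \<in> H1 \<Longrightarrow> \<Gamma> (x - y) = \<Gamma> x - \<Gamma> y"
  using \<Gamma>_add [of "x - y" y] by (simp add: H1_intros)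

lemma \<Gamma>_0: "\<Gamma> 0 = 0"
  using \<Gamma>_diff [of 0 0] by (simp add: H1_intros)

lemma \<Gamma>_bounded: obtains C where "C \<ge> 0" "\<And>x. x \<in> H1 \<Longrightarrow> norm (\<Gamma> x) \<le> C * nrm x"
proof -
  obtain C where C: "\<And>x. x \<in> H1 \<Longrightarrow> norm (\<Gamma> x) \<le> C * nrm x"
    using bp by (auto simp: boundary_pair_def bounded_map_on_def)
  show thesis
  proof (rule that [of "max C 0"])
    fix x assume x: "x \<in> H1"
    have "C * nrm x \<le> max C 0 * nrm x"
      using form_norm_nonneg [OF h_nonneg_form x] by (intro mult_right_mono) auto
    with C [OF x] show "norm (\<Gamma> x) \<le> max C 0 * nrm x" by simp
  qed simp
qed

lemma csubspace_range: "csubspace (\<Gamma> ` H1)"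
  unfolding csubspace_def
proof (intro conjI ballI allI)
  show "0 \<in> \<Gamma> ` H1" using \<Gamma>_0 csubspace_0 [OF csubspace_H1] by force
  show "x + y \<in> \<Gamma> ` H1" if "x \<in> \<Gamma> ` H1" "y \<in> \<Gamma> ` H1" for x y
    using that \<Gamma>_add by (auto simp: H1_intros image_iff) (metis H1_intros(1))
  show "c *\<^sub>C x \<in> \<Gamma> ` H1" if "x \<in> \<Gamma> ` H1" for c x
    using that \<Gamma>_scaleC by (auto simp: image_iff) (metis H1_intros(3))
qed

lemma D_iff: "x \<in> D \<longleftrightarrow> x \<in> H1 \<and> \<Gamma> x = 0"
  by (auto simp: ker_on_def)

lemma D_H1: "x \<in> D \<Longrightarrow> x \<in> H1"
  by (simp add: D_iff)

lemma csubspace_D: "csubspace D"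
  by (auto simp: csubspace_def D_iff H1_intros \<Gamma>_add \<Gamma>_scaleC \<Gamma>_0)

lemmas D_intros = csubspace_add [OF csubspace_D] csubspace_diff [OF csubspace_D] csubspace_scaleC [OF csubspace_D]
  csubspace_0 [OF csubspace_D]

text \<open>Density of the Dirichlet form domain is what gives the description operator in
  \<open>form_op\<close> its meaning.\<close>

lemma D_dense_eq: "(\<And>f. f \<in> D \<Longrightarrow> cinner u f = cinner v f) \<Longrightarrow> u = v"
  using cinner_dense_eq_0 [of D "u - v"] bp by (auto simp: boundary_pair_def cinner_diff_left)

text \<open>The limit exists in \<open>H1\<close> because \<open>h\<close> is closed there;
  boundedness of \<open>\<Gamma>\<close> in the form norm keeps it in the kernel.\<close>

lemma h_closed_form_D: "closed_form D h"
  unfolding closed_form_def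
proof (intro conjI allI impI)
  show "nonneg_form D h"
    using h_nonneg_form sesquilinear_mono [OF h_sesquilinear csubspace_D] D_H1 by (auto simp: nonneg_form_def)
  fix x :: "nat \<Rightarrow> 'h"
  assume x: "range x \<subseteq> D \<and> (\<forall>e>0. \<exists>N. \<forall>m\<ge>N. \<forall>n\<ge>N. nrm (x m - x n) < e)"
  then have xD: "x n \<in> D" for n by auto
  then have "range x \<subseteq> H1" using D_H1 by auto
  with x obtain u where u: "u \<in> H1" "(\<lambda>n. nrm (x n - u)) \<longlonglongrightarrow> 0"
    using h_closed_form unfolding closed_form_def by blast
  obtain C where C: "\<And>x. x \<in> H1 \<Longrightarrow> norm (\<Gamma> x) \<le> C * nrm x" using \<Gamma>_bounded by blast
  \<comment> \<open>The constant sequence is \<open>\<Gamma> (x n - u)\<close>, because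
    \<open>\<Gamma> (x n) = 0\<close>.\<close>
  have "(\<lambda>n. - \<Gamma> u) \<longlonglongrightarrow> 0"
  proof (rule null_comparison)
    show "norm (- \<Gamma> u) \<le> C * nrm (x n - u)" for n
      using C [of "x n - u"] xD [of n] u by (simp add: D_iff H1_intros \<Gamma>_diff)
    show "(\<lambda>n. C * nrm (x n - u)) \<longlonglongrightarrow> 0"
      using tendsto_mult [OF tendsto_const u(2), of C] by simp
  qed
  then have "\<Gamma> u = 0" by (simp add: LIMSEQ_const_iff)
  with u show "\<exists>u\<in>D. (\<lambda>n. nrm (x n - u)) \<longlonglongrightarrow> 0" by (auto simp: D_iff)
qed

text \<open>\<open>weak_sol z f u\<close> is the weak form of \<open>(H\<^sup>D - z) u = f\<close>.\<close>

definition weak_sol :: "complex \<Rightarrow> 'h \<Rightarrow> 'h \<Rightarrow> bool"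
  where "weak_sol z f u \<longleftrightarrow> u \<in> D \<and> (\<forall>k\<in>D. h u k = cinner (f + z *\<^sub>C u) k)"

lemma weak_sol_D: "weak_sol z f u \<Longrightarrow> u \<in> D"
  by (simp add: weak_sol_def)

lemma weak_sol_eq: "weak_sol z f u \<Longrightarrow> k \<in> D \<Longrightarrow> h u k = cinner f k + z * cinner u k"
  by (simp add: weak_sol_def cinner_simps)

text \<open>Weak form of the resolvent identity: a change of the spectral parameter moves into the
  right-hand side.\<close>

lemma weak_sol_shift: "weak_sol z f u \<longleftrightarrow> weak_sol w (f + (z - w) *\<^sub>C u) u"
  by (simp add: weak_sol_def cinner_simps algebra_simps)

lemma weak_sol_diff: "weak_sol z f u \<Longrightarrow> weak_sol z g v \<Longrightarrow> weak_sol z (f - g) (u - v)"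
  by (auto simp: weak_sol_def h_simps D_H1 D_intros cinner_simps algebra_simps)

lemma weak_sol_add: "weak_sol z f u \<Longrightarrow> weak_sol z g v \<Longrightarrow> weak_sol z (f + g) (u + v)"
  by (auto simp: weak_sol_def h_simps D_H1 D_intros cinner_simps algebra_simps)

lemma weak_sol_scaleC: "weak_sol z f u \<Longrightarrow> weak_sol z (c *\<^sub>C f) (c *\<^sub>C u)"
  by (auto simp: weak_sol_def h_simps D_H1 D_intros cinner_simps algebra_simps)

text \<open>Symmetry of the Dirichlet operator: \<open>h u v\<close> is evaluated once by the
  equation for \<open>u\<close> and once, after conjugation, by the equation for
  \<open>v\<close>.\<close>

lemma weak_sol_symmetric:
  assumes "weak_sol z f u" "weak_sol w g v"
  shows "cinner f v + z * cinner u v = cinner u g + cnj w * cinner u v"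
proof -
  have "h u v = cnj (h v u)" using assms by (intro hermitian) (auto simp: weak_sol_def D_H1)
  also have "h v u = cinner g u + w * cinner v u"
    by (rule weak_sol_eq [OF assms(2)]) (rule weak_sol_D [OF assms(1)])
  finally show ?thesis
    using weak_sol_eq [OF assms(1) weak_sol_D [OF assms(2)]]
      cinner_commute [of u g] cinner_commute [of u v] by simp
qed

text \<open>The bridge to the operator-theoretic definitions of spectrum and resolvent; afterwards
  only weak equations are handled.\<close>

lemma weak_sol_iff:
  "weak_sol z f u \<longleftrightarrow> u \<in> form_op_dom D h \<and> form_op D h u - z *\<^sub>C u = f"
proof
  assume w: "weak_sol z f u"
  have "form_op D h u = f + z *\<^sub>C u"
    unfolding form_op_def
    using w by (intro the_equality) (auto simp: weak_sol_def intro: D_dense_eq)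
  then show "u \<in> form_op_dom D h \<and> form_op D h u - z *\<^sub>C u = f"
    using w by (auto simp: form_op_dom_def weak_sol_def)
next
  assume *: "u \<in> form_op_dom D h \<and> form_op D h u - z *\<^sub>C u = f"
  then obtain v where v: "u \<in> D" "\<And>f. f \<in> D \<Longrightarrow> h u f = cinner v f"
    by (auto simp: form_op_dom_def)
  have "form_op D h u = v"
    unfolding form_op_def using v by (intro the_equality) (auto intro: D_dense_eq)
  with * v show "weak_sol z f u" by (auto simp: weak_sol_def)
qed

text \<open>Injectivity has no conjunct of its own: the bound, applied to a difference of two
  solutions with the same data, forces it to vanish.\<close>

lemma not_spectrum_iff:
  "z \<notin> \<Sigma> \<longleftrightarrow> (\<forall>f. \<exists>u. weak_sol z f u) \<and> (\<exists>M. \<forall>f u. weak_sol z f u \<longrightarrow> norm u \<le> M * norm f)"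
proof -
  define A where "A = form_op_dom D h"
  define T where "T u = form_op D h u - z *\<^sub>C u" for u
  have W: "weak_sol z f u \<longleftrightarrow> u \<in> A \<and> T u = f" for f u
    by (simp add: weak_sol_iff A_def T_def)
  have *: "z \<notin> \<Sigma> \<longleftrightarrow> bij_betw T A UNIV \<and> bounded_map_on UNIV norm norm (the_inv_into A T)"
    by (simp add: dir_spectrum_def op_spectrum_def A_def T_def [abs_def])
  show ?thesis
  proof
    assume "z \<notin> \<Sigma>"
    then obtain M where b: "inj_on T A" "T ` A = UNIV" and M: "\<And>x. norm (the_inv_into A T x) \<le> M * norm x"
      by (auto simp: * bij_betw_def bounded_map_on_def)
    have "norm u \<le> M * norm f" if "weak_sol z f u" for f u
      using M [of f] that b by (auto simp: W the_inv_into_f_f)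
    then show "(\<forall>f. \<exists>u. weak_sol z f u) \<and> (\<exists>M. \<forall>f u. weak_sol z f u \<longrightarrow> norm u \<le> M * norm f)"
      using b unfolding W by (metis UNIV_I imageE)
  next
    assume a: "(\<forall>f. \<exists>u. weak_sol z f u) \<and> (\<exists>M. \<forall>f u. weak_sol z f u \<longrightarrow> norm u \<le> M * norm f)"
    then obtain M where M: "\<And>f u. weak_sol z f u \<Longrightarrow> norm u \<le> M * norm f" by blast
    have inj: "inj_on T A"
    proof (rule inj_onI)
      fix u v assume "u \<in> A" "v \<in> A" "T u = T v"
      then have "weak_sol z (T u - T v) (u - v)" by (intro weak_sol_diff) (simp_all add: W)
      from M [OF this] \<open>T u = T v\<close> show "u = v" by simp
    qed
    have ex: "\<exists>u\<in>A. T u = f" for f using conjunct1 [OF a] W by metis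
    then have "T ` A = UNIV" by (metis UNIV_eq_I imageI)
    moreover have "norm (the_inv_into A T f) \<le> M * norm f" for f
      using ex [of f] M [of f] inj unfolding W by (metis the_inv_into_f_f)
    ultimately show "z \<notin> \<Sigma>" using inj unfolding * bij_betw_def bounded_map_on_def by blast
  qed
qed

lemma not_spectrumI:
  "(\<And>f. \<exists>u. weak_sol z f u) \<Longrightarrow> (\<And>f u. weak_sol z f u \<Longrightarrow> norm u \<le> M * norm f) \<Longrightarrow> z \<notin> \<Sigma>"
  by (auto simp: not_spectrum_iff)

lemma R_eqI: "z \<notin> \<Sigma> \<Longrightarrow> weak_sol z f u \<Longrightarrow> R z f = u"
proof -
  assume z: "z \<notin> \<Sigma>" and u: "weak_sol z f u"
  from z have "inj_on (\<lambda>u. form_op D h u - z *\<^sub>C u) (form_op_dom D h)"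
    by (simp add: dir_spectrum_def op_spectrum_def bij_betw_def)
  from the_inv_into_f_f [OF this, of u] u show ?thesis
    by (simp add: weak_sol_iff dir_resolvent_def op_resolvent_def)
qed

lemma R_weak_sol: "z \<notin> \<Sigma> \<Longrightarrow> weak_sol z f (R z f)"
  using R_eqI not_spectrum_iff by metis

text \<open>The constant is made strictly positive because \<open>1 / M\<close> later serves as a
  radius of convergence.\<close>

lemma R_bounded:
  assumes "z \<notin> \<Sigma>"
  obtains M where "M > 0" "\<And>f. norm (R z f) \<le> M * norm f"
proof -
  obtain M where M: "\<And>f. norm (R z f) \<le> M * norm f"
    using assms R_weak_sol [OF assms] not_spectrum_iff by metis
  show thesis
  proof (rule that [of "max M 1"])
    show "norm (R z f) \<le> max M 1 * norm f" for f
      using M [of f] mult_right_mono [of M "max M 1" "norm f"] by simp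
  qed simp
qed

lemma R_add: "z \<notin> \<Sigma> \<Longrightarrow> R z (f + g) = R z f + R z g"
  by (intro R_eqI weak_sol_add R_weak_sol)

lemma R_scaleC: "z \<notin> \<Sigma> \<Longrightarrow> R z (c *\<^sub>C f) = c *\<^sub>C R z f"
  by (intro R_eqI weak_sol_scaleC R_weak_sol)

lemma R_diff: "z \<notin> \<Sigma> \<Longrightarrow> R z (f - g) = R z f - R z g"
  by (intro R_eqI weak_sol_diff R_weak_sol)

lemma R_D: "z \<notin> \<Sigma> \<Longrightarrow> R z f \<in> D"
  using R_weak_sol weak_sol_D by blast

text \<open>At -1 the weak equation asks to represent \<open>cinner f\<close> in the inner product
  of the form domain, so Riesz solves it. Testing the equation with \<open>u\<close> itself gives
  the bound.\<close>

lemma minus_one_not_spectrum: "-1 \<notin> \<Sigma>"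
proof (rule not_spectrumI)
  fix f
  have nnD: "nonneg_form D h" using h_closed_form_D by (simp add: closed_form_def)
  have "cmod (cinner f x) \<le> norm f * nrm x" if "x \<in> D" for x
    using norm_le_form_norm [OF nnD that] cinner_Cauchy_Schwarz [of f x]
    by (meson mult_left_mono norm_ge_zero order_trans)
  from closed_form_Riesz [OF h_closed_form_D _ _ this]
  obtain u where "u \<in> D" "\<And>k. k \<in> D \<Longrightarrow> shifted_form h (-1) u k = cinner f k"
    by (metis cinner_add_right cinner_scaleC_right)
  then have "weak_sol (-1) f u"
    by (auto simp: weak_sol_def shifted_form_def cinner_simps algebra_simps)
  then show "\<exists>u. weak_sol (-1) f u" ..
next
  fix f u assume w: "weak_sol (-1) f u"
  then have "u \<in> H1" by (simp add: weak_sol_D D_H1)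
  have "h u u + cinner u u = cinner f u"
    using weak_sol_eq [OF w weak_sol_D [OF w]] by simp
  then have "Re (h u u) + (norm u)\<^sup>2 = Re (cinner f u)"
    by (simp add: complex_eq_iff cinner_self del: of_real_power)
  then have "(norm u)\<^sup>2 \<le> norm f * norm u"
    using nonneg_form_Re_nonneg [OF h_nonneg_form \<open>u \<in> H1\<close>] complex_Re_le_cmod [of "cinner f u"]
      cinner_Cauchy_Schwarz [of f u] by linarith
  then show "norm u \<le> 1 * norm f"
    by (cases "u = 0") (simp_all add: power2_eq_square)
qed

text \<open>Surjectivity of \<open>H\<^sup>D - cnj z\<close>: a solution is obtained by applying the Hilbert space adjoint of
  \<open>R z\<close>, and it lies in the form domain because \<open>R (-1)\<close> maps onto the operator domain.\<close>

lemma cnj_not_spectrum: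
  assumes z: "z \<notin> \<Sigma>"
  shows "cnj z \<notin> \<Sigma>"
proof -
  obtain M where M: "M > 0" "\<And>f. norm (R z f) \<le> M * norm f" using R_bounded [OF z] by blast
  note m1 = minus_one_not_spectrum
  show ?thesis
  proof (rule not_spectrumI)
    fix f
    have "cmod (cinner f (R z x)) \<le> (norm f * M) * norm x" for x
      using cinner_Cauchy_Schwarz [of f "R z x"] mult_left_mono [OF M(2) [of x], of "norm f"]
      by (simp add: mult.assoc)
    \<comment> \<open>\<open>u\<close> is the adjoint of \<open>R z\<close> applied to
      \<open>f\<close>; so far it is only known to lie in the ambient space.\<close>
    then obtain u where u: "\<And>k. cinner u k = cinner f (R z k)"
      using cinner_Riesz [of "\<lambda>k. cinner f (R z k)" "norm f * M"]
      by (auto simp: R_add [OF z] R_scaleC [OF z] cinner_simps)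
    \<comment> \<open>The equation at \<open>cnj z\<close>, rewritten at -1, would force
      \<open>u = u'\<close>. Since \<open>u'\<close> lies in \<open>D\<close> by construction, it
      suffices to prove this equality.\<close>
    define u' where "u' = R (-1) (f + (cnj z + 1) *\<^sub>C u)"
    have w': "weak_sol (-1) (f + (cnj z + 1) *\<^sub>C u) u'"
      unfolding u'_def by (rule R_weak_sol [OF m1])
    have "cinner (u - u') v = 0" for v
    proof -
      define x where "x = R (-1) v"
      have wx: "weak_sol (-1) v x" unfolding x_def by (rule R_weak_sol [OF m1])
      \<comment> \<open>Every \<open>v\<close> is tested through \<open>x = R (-1) v\<close>, which
        is also a value of \<open>R z\<close>; the defining property of \<open>u\<close> then
        applies.\<close>
      then have "weak_sol z (v - (1 + z) *\<^sub>C x) x"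
        by (subst (asm) weak_sol_shift [of _ _ _ z]) (simp add: scaleC_diff_left scaleC_add_left algebra_simps)
      then have "R z (v - (1 + z) *\<^sub>C x) = x" by (rule R_eqI [OF z])
      with u [of "v - (1 + z) *\<^sub>C x"] have "cinner u v = cinner f x + (1 + cnj z) * cinner u x"
        by (simp add: cinner_simps algebra_simps)
      moreover have "cinner u' v = cinner f x + (1 + cnj z) * cinner u x"
        using weak_sol_symmetric [OF w' wx] by (simp add: cinner_simps algebra_simps)
      ultimately show ?thesis by (simp add: cinner_simps)
    qed
    then have "u = u'" using cinner_self [of "u - u'"] by simp
    with w' have "weak_sol (-1) (f + (cnj z + 1) *\<^sub>C u) u" by simp
    then have "weak_sol (cnj z) f u" by (subst weak_sol_shift [of _ _ _ "-1"]) simp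
    then show "\<exists>u. weak_sol (cnj z) f u" ..
  next
    fix f u assume w: "weak_sol (cnj z) f u"
    define x where "x = R z u"
    have wx: "weak_sol z u x" unfolding x_def by (rule R_weak_sol [OF z])
    \<comment> \<open>The terms with \<open>z\<close> cancel in the symmetry relation, so the bound
      for \<open>R z\<close> passes to \<open>cnj z\<close>.\<close>
    have "cinner u u = cinner x f"
      using weak_sol_symmetric [OF wx w] by simp
    then have "(norm u)\<^sup>2 = cmod (cinner x f)" unfolding cinner_self by (metis abs_power2 norm_of_real)
    also have "\<dots> \<le> norm x * norm f" by (rule cinner_Cauchy_Schwarz)
    also have "\<dots> \<le> M * norm u * norm f"
      using M(2) [of u] by (simp add: x_def mult_right_mono)
    finally show "norm u \<le> M * norm f"
      using M(1) by (cases "u = 0") (simp_all add: power2_eq_square algebra_simps)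
  qed
qed

text \<open>By the contraction principle for \<open>u \<mapsto> R z (f + (\<zeta> - z) u)\<close>.\<close>

lemma near_not_spectrum:
  assumes z: "z \<notin> \<Sigma>" and M: "M > 0" "\<And>f. norm (R z f) \<le> M * norm f"
    and \<zeta>: "cmod (\<zeta> - z) * M < 1"
  shows "\<zeta> \<notin> \<Sigma>"
proof -
  have iff: "weak_sol \<zeta> f u \<longleftrightarrow> R z (f + (\<zeta> - z) *\<^sub>C u) = u" for f u
    using weak_sol_shift [of \<zeta> f u z] R_eqI [OF z] R_weak_sol [OF z] by metis
  show ?thesis
  proof (rule not_spectrumI)
    fix f
    have "dist (R z (f + (\<zeta> - z) *\<^sub>C x)) (R z (f + (\<zeta> - z) *\<^sub>C y)) \<le> (cmod (\<zeta> - z) * M) * dist x y" for x y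
    proof -
      have "R z (f + (\<zeta> - z) *\<^sub>C x) - R z (f + (\<zeta> - z) *\<^sub>C y) = R z ((\<zeta> - z) *\<^sub>C (x - y))"
        by (simp add: R_add [OF z] R_scaleC [OF z] scaleC_diff_right R_diff [OF z])
      then show ?thesis
        using M(2) [of "(\<zeta> - z) *\<^sub>C (x - y)"] by (simp add: dist_norm norm_scaleC mult_ac)
    qed
    then have "\<exists>!u. R z (f + (\<zeta> - z) *\<^sub>C u) = u"
      using \<zeta> M by (intro banach_fix_type [of "cmod (\<zeta> - z) * M"]) auto
    then show "\<exists>u. weak_sol \<zeta> f u" unfolding iff by blast
  next
    fix f u assume "weak_sol \<zeta> f u"
    then have "R z (f + (\<zeta> - z) *\<^sub>C u) = u" by (simp add: iff)
    then have "norm u \<le> M * norm (f + (\<zeta> - z) *\<^sub>C u)" using M(2) by metis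
    also have "\<dots> \<le> M * (norm f + cmod (\<zeta> - z) * norm u)"
      using M(1) norm_triangle_ineq [of f "(\<zeta> - z) *\<^sub>C u"] by (simp add: norm_scaleC)
    finally have "(1 - cmod (\<zeta> - z) * M) * norm u \<le> M * norm f" by (simp add: algebra_simps)
    with \<zeta> show "norm u \<le> (M / (1 - cmod (\<zeta> - z) * M)) * norm f"
      by (simp add: pos_le_divide_eq mult.commute)
  qed
qed

section \<open>The Dirichlet solution operator\<close>

lemma weak_solutions_iff: "u \<in> weak_solutions H1 h \<Gamma> z \<longleftrightarrow> u \<in> H1 \<and> (\<forall>f\<in>D. h u f = z * cinner u f)"
  by (simp add: weak_solutions_def)

text \<open>The correction by \<open>R z u\<close> removes the defect of \<open>u\<close> in the
  equation at \<open>z\<close> and lies in \<open>ker \<Gamma>\<close>, so the boundary value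
  survives.\<close>

lemma weak_solution_shift:
  assumes z: "z \<notin> \<Sigma>" and u: "u \<in> weak_solutions H1 h \<Gamma> w"
  shows "u + (z - w) *\<^sub>C R z u \<in> weak_solutions H1 h \<Gamma> z"
    and "\<Gamma> (u + (z - w) *\<^sub>C R z u) = \<Gamma> u"
proof -
  have "R z u \<in> H1" "\<Gamma> (R z u) = 0" using R_D [OF z, of u] by (auto simp: D_iff)
  then show "u + (z - w) *\<^sub>C R z u \<in> weak_solutions H1 h \<Gamma> z"
    and "\<Gamma> (u + (z - w) *\<^sub>C R z u) = \<Gamma> u"
    using u weak_sol_eq [OF R_weak_sol [OF z], of _ u]
    by (auto simp: weak_solutions_iff H1_intros h_simps D_H1 cinner_simps \<Gamma>_add \<Gamma>_scaleC algebra_simps)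
qed

text \<open>Subtracting from \<open>g\<close> its orthogonal projection onto \<open>D\<close> in the
  form domain gives the solution at -1; shifting gives the one at \<open>z\<close>.\<close>

lemma ex_weak_solution:
  assumes z: "z \<notin> \<Sigma>" and g: "g \<in> H1"
  shows "\<exists>u\<in>weak_solutions H1 h \<Gamma> z. \<Gamma> u = \<Gamma> g"
proof -
  have "cmod (shifted_form h (-1) g x) \<le> nrm g * nrm x" if "x \<in> D" for x
    using shifted_form_Cauchy_Schwarz [OF h_nonneg_form g] that by (simp add: D_H1)
  from closed_form_Riesz [OF h_closed_form_D _ _ this]
  obtain f where f: "f \<in> D" "\<And>k. k \<in> D \<Longrightarrow> shifted_form h (-1) f k = shifted_form h (-1) g k"
    using g by (auto simp: sesquilinear_simps [OF sesquilinear_shifted_form [OF h_sesquilinear]] D_H1)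
  have "g - f \<in> weak_solutions H1 h \<Gamma> (-1)"
    unfolding weak_solutions_iff
  proof (intro conjI ballI)
    show "g - f \<in> H1" using f g by (simp add: D_H1 H1_intros)
    fix k assume k: "k \<in> D"
    have "shifted_form h (-1) (g - f) k = 0"
      using f g k by (simp add: sesquilinear_simps [OF sesquilinear_shifted_form [OF h_sesquilinear]] D_H1)
    then show "h (g - f) k = - 1 * cinner (g - f) k"
      by (simp add: shifted_form_def add_eq_0_iff)
  qed
  moreover have "\<Gamma> (g - f) = \<Gamma> g" using f g by (simp add: \<Gamma>_diff D_iff)
  ultimately show ?thesis using weak_solution_shift [OF z, of "g - f" "-1"] by metis
qed

lemma weak_solution_unique:
  assumes z: "z \<notin> \<Sigma>" and "u \<in> weak_solutions H1 h \<Gamma> z" "v \<in> weak_solutions H1 h \<Gamma> z" "\<Gamma> u = \<Gamma> v"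
  shows "u = v"
proof -
  have "weak_sol z 0 (u - v)"
    using assms by (auto simp: weak_sol_def D_iff weak_solutions_iff H1_intros \<Gamma>_diff h_simps
        cinner_simps algebra_simps)
  from R_eqI [OF z this] R_scaleC [OF z, of 0 0] show ?thesis by simp
qed

text \<open>The means by which linearity and the shift formula for \<open>S\<close> follow: the
  right-hand side is recognised as a weak solution with the correct boundary value.\<close>

lemma S_eqI: "z \<notin> \<Sigma> \<Longrightarrow> u \<in> weak_solutions H1 h \<Gamma> z \<Longrightarrow> \<Gamma> u = \<phi> \<Longrightarrow> S z \<phi> = u"
  unfolding dir_solution_def
  by (rule the_inv_into_f_eq) (auto intro: inj_onI weak_solution_unique)

lemma
  assumes "z \<notin> \<Sigma>" "\<phi> \<in> \<Gamma> ` H1"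
  shows S_weak: "S z \<phi> \<in> weak_solutions H1 h \<Gamma> z" and \<Gamma>_S: "\<Gamma> (S z \<phi>) = \<phi>"
  using assms ex_weak_solution S_eqI by (metis imageE)+

lemma S_H1: "z \<notin> \<Sigma> \<Longrightarrow> \<phi> \<in> \<Gamma> ` H1 \<Longrightarrow> S z \<phi> \<in> H1"
  using S_weak by (simp add: weak_solutions_iff)

lemma S_eq: "z \<notin> \<Sigma> \<Longrightarrow> \<phi> \<in> \<Gamma> ` H1 \<Longrightarrow> f \<in> D \<Longrightarrow> h (S z \<phi>) f = z * cinner (S z \<phi>) f"
  using S_weak by (simp add: weak_solutions_iff)

lemma S_shift:
  assumes "z \<notin> \<Sigma>" "w \<notin> \<Sigma>" "\<phi> \<in> \<Gamma> ` H1"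
  shows "S z \<phi> = S w \<phi> + (z - w) *\<^sub>C R z (S w \<phi>)"
  using assms weak_solution_shift [OF assms(1) S_weak [OF assms(2,3)]] \<Gamma>_S
  by (intro S_eqI) auto

lemma S_add:
  assumes "z \<notin> \<Sigma>" "\<phi> \<in> \<Gamma> ` H1" "\<psi> \<in> \<Gamma> ` H1"
  shows "S z (\<phi> + \<psi>) = S z \<phi> + S z \<psi>"
  using assms by (intro S_eqI)
    (auto simp: weak_solutions_iff S_H1 S_eq H1_intros h_simps D_H1 cinner_simps \<Gamma>_add \<Gamma>_S algebra_simps)

lemma S_scaleC:
  assumes "z \<notin> \<Sigma>" "\<phi> \<in> \<Gamma> ` H1"
  shows "S z (c *\<^sub>C \<phi>) = c *\<^sub>C S z \<phi>"
  using assms by (intro S_eqI)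
    (auto simp: weak_solutions_iff S_H1 S_eq H1_intros h_simps D_H1 cinner_simps \<Gamma>_scaleC \<Gamma>_S)

end

context boundary_setting
begin

section \<open>The Dirichlet-to-Neumann form\<close>

text \<open>Two extensions of the same boundary value differ by an element of \<open>D\<close>, on
  which the shifted form of \<open>S z \<phi>\<close> vanishes.\<close>

lemma shifted_form_diff_range:
  assumes "z \<notin> \<Sigma>" "\<phi> \<in> \<Gamma> ` H1" "g \<in> H1" "g' \<in> H1" "\<Gamma> g = \<Gamma> g'"
  shows "shifted_form h z (S z \<phi>) g = shifted_form h z (S z \<phi>) g'"
proof -
  have "g - g' \<in> D" using assms by (simp add: D_iff H1_intros \<Gamma>_diff)
  from S_eq [OF assms(1,2) this]
  have "h (S z \<phi>) g - h (S z \<phi>) g' = z * (cinner (S z \<phi>) g - cinner (S z \<phi>) g')"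
    by (simp only: h_simps(6) [OF assms(3,4) S_H1 [OF assms(1,2)]] cinner_diff_right)
  then show ?thesis by (simp add: shifted_form_def algebra_simps)
qed

lemma L_eq:
  assumes "z \<notin> \<Sigma>" "\<phi> \<in> \<Gamma> ` H1" "g \<in> H1" "\<Gamma> g = \<psi>"
  shows "\<L> z \<phi> \<psi> = shifted_form h z (S z \<phi>) g"
  unfolding dtn_form_def
proof (rule the_equality)
  show "\<exists>g'\<in>H1. \<Gamma> g' = \<psi> \<and> shifted_form h z (S z \<phi>) g = shifted_form h z (S z \<phi>) g'"
    using assms(3,4) by blast
  show "c = shifted_form h z (S z \<phi>) g"
    if "\<exists>g'\<in>H1. \<Gamma> g' = \<psi> \<and> c = shifted_form h z (S z \<phi>) g'" for c
    using that shifted_form_diff_range [OF assms(1,2) _ assms(3)] assms(4) by metis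
qed

text \<open>The extension may be \<open>S w \<psi>\<close> for any \<open>w\<close> outside the
  spectrum; the proofs below depend on choosing \<open>w\<close> well.\<close>

lemma L_eq_S:
  assumes "z \<notin> \<Sigma>" "w \<notin> \<Sigma>" "\<phi> \<in> \<Gamma> ` H1" "\<psi> \<in> \<Gamma> ` H1"
  shows "\<L> z \<phi> \<psi> = h (S z \<phi>) (S w \<psi>) - z * cinner (S z \<phi>) (S w \<psi>)"
  using L_eq [of z \<phi> "S w \<psi>" \<psi>] assms by (simp add: shifted_form_def S_H1 \<Gamma>_S)

lemma sesquilinear_L:
  assumes "z \<notin> \<Sigma>"
  shows "sesquilinear_on (\<Gamma> ` H1) (\<L> z)"
proof -
  have *: "\<L> z \<phi> \<psi> = h (S z \<phi>) (S z \<psi>) - z * cinner (S z \<phi>) (S z \<psi>)"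
    if "\<phi> \<in> \<Gamma> ` H1" "\<psi> \<in> \<Gamma> ` H1" for \<phi> \<psi>
    using L_eq_S assms that by blast
  show ?thesis
    unfolding sesquilinear_on_def
    by (intro conjI ballI allI csubspace_range)
      (simp_all add: * csubspace_add [OF csubspace_range] csubspace_scaleC [OF csubspace_range]
        S_add [OF assms] S_scaleC [OF assms] S_H1 [OF assms] H1_intros h_simps cinner_simps algebra_simps)
qed

text \<open>With the extensions \<open>S (cnj z) \<phi>\<close> on one side and
  \<open>S z \<psi>\<close> on the other, both forms are evaluated on the same pair of
  vectors.\<close>

lemma L_adjoint:
  assumes z: "z \<notin> \<Sigma>" and \<phi>: "\<phi> \<in> \<Gamma> ` H1" and \<psi>: "\<psi> \<in> \<Gamma> ` H1"
  shows "cnj (\<L> z \<psi> \<phi>) = \<L> (cnj z) \<phi> \<psi>"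
proof -
  note z' = cnj_not_spectrum [OF z]
  have "h (S (cnj z) \<phi>) (S z \<psi>) = cnj (h (S z \<psi>) (S (cnj z) \<phi>))"
    using assms z' by (intro hermitian S_H1)
  then show ?thesis
    using L_eq_S [OF z z' \<psi> \<phi>] L_eq_S [OF z' z \<phi> \<psi>] cinner_commute [of "S (cnj z) \<phi>" "S z \<psi>"]
    by simp
qed

text \<open>The adjoint relation expresses the form at \<open>w\<close> through
  \<open>S z \<phi>\<close> and \<open>S (cnj w) \<psi>\<close> as well, so the \<open>h\<close>
  terms cancel.\<close>

lemma L_diff:
  assumes z: "z \<notin> \<Sigma>" and w: "w \<notin> \<Sigma>" and \<phi>: "\<phi> \<in> \<Gamma> ` H1" and \<psi>: "\<psi> \<in> \<Gamma> ` H1"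
  shows "\<L> z \<phi> \<psi> - \<L> w \<phi> \<psi> = - (z - w) * cinner (S z \<phi>) (S (cnj w) \<psi>)"
proof -
  note w' = cnj_not_spectrum [OF w]
  have "\<L> w \<phi> \<psi> = cnj (\<L> (cnj w) \<psi> \<phi>)"
    using L_adjoint [OF w' \<phi> \<psi>] by simp
  also have "\<dots> = h (S z \<phi>) (S (cnj w) \<psi>) - w * cinner (S z \<phi>) (S (cnj w) \<psi>)"
    using L_eq_S [OF w' z \<psi> \<phi>] hermitian [OF S_H1 [OF w' \<psi>] S_H1 [OF z \<phi>]]
      cinner_commute [of "S z \<phi>" "S (cnj w) \<psi>"] by simp
  finally show ?thesis using L_eq_S [OF z w' \<phi> \<psi>] by (simp add: algebra_simps)
qed

lemma L_diff':
  assumes z: "z \<notin> \<Sigma>" and w: "w \<notin> \<Sigma>" and \<phi>: "\<phi> \<in> \<Gamma> ` H1" and \<psi>: "\<psi> \<in> \<Gamma> ` H1"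
  shows "\<L> z \<phi> \<psi> - \<L> w \<phi> \<psi> = - (z - w) * cinner (S w \<phi>) (S (cnj z) \<psi>)"
  using L_diff [OF w z \<phi> \<psi>] by (simp add: algebra_simps)

section \<open>Boundedness\<close>

text \<open>The bound of the resolvent in the ambient norm improves to the form norm by testing its
  weak equation with the solution itself.\<close>

lemma R_form_bounded:
  assumes z: "z \<notin> \<Sigma>"
  obtains K where "K \<ge> 0" "\<And>f. nrm (R z f) \<le> K * norm f"
proof -
  obtain M where M: "M > 0" "\<And>f. norm (R z f) \<le> M * norm f" using R_bounded [OF z] by blast
  define K where "K = (1 + cmod z) * M\<^sup>2 + M"
  have K: "K \<ge> 0" using M by (simp add: K_def)
  have "nrm (R z f) \<le> sqrt K * norm f" for f
  proof -
    define u where "u = R z f"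
    have "h u u = cinner f u + z * cinner u u"
      unfolding u_def by (rule weak_sol_eq [OF R_weak_sol [OF z] R_D [OF z]])
    then have "Re (h u u) \<le> cmod (cinner f u + z * cinner u u)"
      by (metis complex_Re_le_cmod)
    also have "\<dots> \<le> norm f * norm u + cmod z * (norm u)\<^sup>2"
      using norm_triangle_ineq [of "cinner f u" "z * cinner u u"] cinner_Cauchy_Schwarz [of f u]
      by (simp add: norm_mult cinner_self norm_power)
    finally have "Re (h u u) + (norm u)\<^sup>2 \<le> norm f * norm u + (1 + cmod z) * (norm u)\<^sup>2"
      by (simp add: algebra_simps)
    also have "\<dots> \<le> norm f * (M * norm f) + (1 + cmod z) * (M * norm f)\<^sup>2"
      using M(2) [of f] by (intro add_mono mult_left_mono power_mono) (simp_all add: u_def)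
    also have "\<dots> = K * (norm f)\<^sup>2" by (simp add: K_def power2_eq_square algebra_simps)
    finally have "nrm u \<le> sqrt (K * (norm f)\<^sup>2)"
      unfolding form_norm_def by (rule real_sqrt_le_mono)
    then show ?thesis by (simp add: u_def real_sqrt_mult)
  qed
  then show thesis using K by (intro that [of "sqrt K"]) auto
qed

lemma C1_op_bounded:
  assumes z: "z \<notin> \<Sigma>"
  shows "bounded_map_on H1 nrm nrm (C1_op H1 h \<Gamma> z w)"
proof -
  obtain K where K: "K \<ge> 0" "\<And>f. nrm (R z f) \<le> K * norm f" using R_form_bounded [OF z] by blast
  have "nrm (C1_op H1 h \<Gamma> z w f) \<le> (1 + cmod (z - w) * K) * nrm f" if f: "f \<in> H1" for f
  proof -
    have r: "R z f \<in> H1" using R_D [OF z] by (rule D_H1)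
    have "nrm (C1_op H1 h \<Gamma> z w f) \<le> nrm f + cmod (z - w) * nrm (R z f)"
      unfolding C1_op_def
      using form_norm_triangle [OF h_nonneg_form f, of "(z - w) *\<^sub>C R z f"] r f
      by (simp add: form_norm_scaleC [OF h_nonneg_form] H1_intros)
    also have "\<dots> \<le> nrm f + cmod (z - w) * (K * nrm f)"
      using K norm_le_form_norm [OF h_nonneg_form f]
      by (intro add_left_mono mult_left_mono order_trans [OF K(2)]) auto
    finally show ?thesis by (simp add: algebra_simps)
  qed
  then show ?thesis unfolding bounded_map_on_def by blast
qed

text \<open>As \<open>half_norm\<close> is the form norm of \<open>S (-1) \<phi>\<close>, every
  bound on \<open>C1_op\<close> becomes a bound on \<open>S z\<close>.\<close>

lemma S_C1_op: "z \<notin> \<Sigma> \<Longrightarrow> \<phi> \<in> \<Gamma> ` H1 \<Longrightarrow> S z \<phi> = C1_op H1 h \<Gamma> z (-1) (S (-1) \<phi>)"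
  unfolding C1_op_def by (intro S_shift minus_one_not_spectrum)

lemma hnrm_nonneg: "\<phi> \<in> \<Gamma> ` H1 \<Longrightarrow> 0 \<le> hnrm \<phi>"
  by (simp add: half_norm_def form_norm_nonneg [OF h_nonneg_form] S_H1 minus_one_not_spectrum)

lemma S_bounded: "z \<notin> \<Sigma> \<Longrightarrow> bounded_map_on (\<Gamma> ` H1) hnrm nrm (S z)"
  using C1_op_bounded [of z "-1"] S_H1 [OF minus_one_not_spectrum]
  unfolding bounded_map_on_def half_norm_def by (metis S_C1_op)

end

section \<open>Operator norms as suprema of quotients\<close>

lemma bdd_above_onorm_on:
  assumes "bounded_map_on X nX nY T" "\<And>x. x \<in> X \<Longrightarrow> 0 \<le> nX x"
  shows "bdd_above ((\<lambda>x. nY (T x) / nX x) ` X)"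
proof -
  obtain C where C: "\<And>x. x \<in> X \<Longrightarrow> nY (T x) \<le> C * nX x"
    using assms(1) unfolding bounded_map_on_def by blast
  \<comment> \<open>Where \<open>nX x = 0\<close> the quotient is 0 by the division convention,
    hence the maximum with 0.\<close>
  have "nY (T x) / nX x \<le> max C 0" if "x \<in> X" for x
    using C [OF that] assms(2) [OF that]
    by (cases "nX x = 0") (auto simp: pos_divide_le_eq le_max_iff_disj)
  then show ?thesis by (intro bdd_aboveI) auto
qed

lemma le_onorm_on:
  assumes "bounded_map_on X nX nY T" "\<And>x. x \<in> X \<Longrightarrow> 0 \<le> nX x" "x \<in> X"
  shows "nY (T x) \<le> onorm_on X nX nY T * nX x"
proof (cases "nX x = 0")
  case True
  with assms show ?thesis by (auto simp: bounded_map_on_def)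
next
  case False
  have "nY (T x) / nX x \<le> onorm_on X nX nY T"
    unfolding onorm_on_def
    by (rule cSUP_upper [OF assms(3) bdd_above_onorm_on [OF assms(1,2)]])
  with False assms(2) [OF assms(3)] show ?thesis by (simp add: pos_divide_le_eq)
qed

context boundary_setting
begin

text \<open>Each quotient in the supremum for \<open>S z\<close> at \<open>\<phi>\<close> is the
  quotient for \<open>C1_op\<close> at \<open>S (-1) \<phi>\<close>.\<close>

lemma L_bound_le:
  assumes z: "z \<notin> \<Sigma>"
  shows "L_bound H1 h \<Gamma> z \<le> 1 + cmod (z + 1) * C1_norm H1 h \<Gamma> z (-1)"
proof -
  note m1 = minus_one_not_spectrum
  have "onorm_on (\<Gamma> ` H1) hnrm nrm (S z) \<le> C1_norm H1 h \<Gamma> z (-1)"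
    unfolding onorm_on_def [of "\<Gamma> ` H1"]
  proof (rule cSUP_least)
    show "\<Gamma> ` H1 \<noteq> {}" using H1_intros(4) by blast
    fix \<phi> assume \<phi>: "\<phi> \<in> \<Gamma> ` H1"
    have "nrm (C1_op H1 h \<Gamma> z (-1) (S (-1) \<phi>)) / nrm (S (-1) \<phi>) \<le> C1_norm H1 h \<Gamma> z (-1)"
      unfolding C1_norm_def onorm_on_def
      by (rule cSUP_upper [OF S_H1 [OF m1 \<phi>]])
        (rule bdd_above_onorm_on [OF C1_op_bounded [OF z] form_norm_nonneg [OF h_nonneg_form]])
    then show "nrm (S z \<phi>) / hnrm \<phi> \<le> C1_norm H1 h \<Gamma> z (-1)"
      by (simp add: S_C1_op [OF z \<phi>] half_norm_def)
  qed
  then show ?thesis unfolding L_bound_def by (intro add_left_mono mult_left_mono) auto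
qed

text \<open>\<open>S z \<phi>\<close> and \<open>S (-1) \<phi>\<close> differ by an element of the Dirichlet form domain, which is orthogonal
  to \<open>S (-1) \<psi>\<close> in the inner product of the form domain.\<close>

lemma L_bounded:
  assumes z: "z \<notin> \<Sigma>" and \<phi>: "\<phi> \<in> \<Gamma> ` H1" and \<psi>: "\<psi> \<in> \<Gamma> ` H1"
  shows "cmod (\<L> z \<phi> \<psi>) \<le> L_bound H1 h \<Gamma> z * hnrm \<phi> * hnrm \<psi>"
proof -
  note m1 = minus_one_not_spectrum
  define s t d where "s = S (-1) \<phi>" and "t = S (-1) \<psi>" and "d = S z \<phi> - s"
  define B where "B = onorm_on (\<Gamma> ` H1) hnrm nrm (S z)"
  have H1: "s \<in> H1" "t \<in> H1" "S z \<phi> \<in> H1" using assms m1 by (auto simp: s_def t_def S_H1)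
  have d: "d \<in> D" using assms m1 H1 by (simp add: d_def D_iff H1_intros \<Gamma>_diff \<Gamma>_S s_def)
  have "h d t = cnj (h t d)" using H1 d by (intro hermitian) (auto simp: D_H1)
  also have "h t d = - cinner t d" using S_eq [OF m1 \<psi> d] by (simp add: t_def)
  finally have dt: "h d t = - cinner d t" using cinner_commute [of d t] by simp
  have S: "S z \<phi> = s + d" by (simp add: d_def)
  have "\<L> z \<phi> \<psi> = h (s + d) t - z * cinner (s + d) t"
    using L_eq_S [OF z m1 \<phi> \<psi>] by (simp add: S t_def)
  \<comment> \<open>Orthogonality removes \<open>d\<close> from the form part, which leaves the
    summand 1 of \<open>L_bound\<close>; the rest carries the factor \<open>z + 1\<close>.\<close>
  also have "\<dots> = shifted_form h (-1) s t - (z + 1) * cinner (s + d) t"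
    using H1 d dt by (simp add: shifted_form_def h_simps D_H1 cinner_simps algebra_simps)
  finally have "cmod (\<L> z \<phi> \<psi>) \<le> cmod (shifted_form h (-1) s t) + cmod (z + 1) * cmod (cinner (S z \<phi>) t)"
    by (simp add: S norm_triangle_ineq4 flip: norm_mult)
  also have "\<dots> \<le> nrm s * nrm t + cmod (z + 1) * ((B * hnrm \<phi>) * nrm t)"
  proof (intro add_mono mult_left_mono shifted_form_Cauchy_Schwarz [OF h_nonneg_form] H1)
    have "nrm (S z \<phi>) \<le> B * hnrm \<phi>"
      unfolding B_def by (rule le_onorm_on [OF S_bounded [OF z] hnrm_nonneg \<phi>])
    then have "norm (S z \<phi>) \<le> B * hnrm \<phi>"
      using norm_le_form_norm [OF h_nonneg_form H1(3)] by simp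
    then have "norm (S z \<phi>) * norm t \<le> (B * hnrm \<phi>) * nrm t"
      using norm_le_form_norm [OF h_nonneg_form H1(2)] order_trans [OF norm_ge_zero]
      by (intro mult_mono) auto
    then show "cmod (cinner (S z \<phi>) t) \<le> B * hnrm \<phi> * nrm t"
      using cinner_Cauchy_Schwarz [of "S z \<phi>" t] by simp
  qed simp
  also have "\<dots> = L_bound H1 h \<Gamma> z * hnrm \<phi> * hnrm \<psi>"
    by (simp add: L_bound_def B_def half_norm_def s_def t_def algebra_simps)
  finally show ?thesis .
qed

section \<open>Real spectral parameters\<close>

lemma L_diagonal:
  assumes "z \<notin> \<Sigma>" "\<phi> \<in> \<Gamma> ` H1"
  shows "\<L> z \<phi> \<phi> = h (S z \<phi>) (S z \<phi>) - z * complex_of_real ((norm (S z \<phi>))\<^sup>2)"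
  using L_eq_S [OF assms(1,1,2,2)] by (simp add: cinner_self)

lemma h_self: "u \<in> H1 \<Longrightarrow> h u u = complex_of_real (Re (h u u))" "u \<in> H1 \<Longrightarrow> 0 \<le> Re (h u u)"
  using h_nonneg_form by (auto simp: nonneg_form_def less_eq_complex_def complex_eq_iff)

lemma L_real:
  assumes "complex_of_real \<mu> \<notin> \<Sigma>" "\<phi> \<in> \<Gamma> ` H1"
  shows "\<L> (complex_of_real \<mu>) \<phi> \<phi>
    = complex_of_real (Re (h (S \<mu> \<phi>) (S \<mu> \<phi>)) - \<mu> * (norm (S \<mu> \<phi>))\<^sup>2)"
  using L_diagonal [OF assms] h_self(1) [OF S_H1 [OF assms]] by simp

lemma L_nonneg:
  assumes "complex_of_real \<mu> \<notin> \<Sigma>" "\<phi> \<in> \<Gamma> ` H1" "\<mu> \<le> 0"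
  shows "0 \<le> \<L> (complex_of_real \<mu>) \<phi> \<phi>"
  using h_self(2) [OF S_H1 [OF assms(1,2)]] assms(3)
  by (simp add: L_real [OF assms(1,2)] less_eq_complex_def mult_nonpos_nonneg
      order_trans [OF mult_nonpos_nonneg])

text \<open>Split \<open>v\<close> into the solution \<open>s\<close> and a Dirichlet part
  \<open>d\<close>: the cross terms cancel, and \<open>d\<close> contributes a non-negative amount
  for \<open>\<mu> \<le> 0\<close>.\<close>

lemma L_minimal:
  assumes \<mu>: "complex_of_real \<mu> \<notin> \<Sigma>" "\<mu> \<le> 0" and v: "v \<in> H1"
  shows "Re (\<L> (complex_of_real \<mu>) (\<Gamma> v) (\<Gamma> v)) \<le> Re (h v v) - \<mu> * (norm v)\<^sup>2"
proof -
  define s d where "s = S \<mu> (\<Gamma> v)" and "d = v - s"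
  have s: "s \<in> H1" using \<mu> v by (simp add: s_def S_H1)
  then have d: "d \<in> D" using v \<mu> by (simp add: d_def D_iff H1_intros \<Gamma>_diff s_def \<Gamma>_S)
  have sd: "h s d = \<mu> * cinner s d" using S_eq [OF \<mu>(1) _ d] v by (simp add: s_def)
  have "h d s = cnj (h s d)" using s d by (intro hermitian) (auto simp: D_H1)
  with sd have ds: "h d s = \<mu> * cinner d s" using cinner_commute [of d s] by simp
  have vv: "v = s + d" by (simp add: d_def)
  have "h v v - \<mu> * cinner v v = (h s s - \<mu> * cinner s s) + (h d d - \<mu> * cinner d d)"
    unfolding vv using s d by (simp add: h_simps D_H1 H1_intros cinner_simps sd ds algebra_simps)
  then have "Re (h v v - \<mu> * cinner v v) = Re (h s s - \<mu> * cinner s s) + Re (h d d - \<mu> * cinner d d)"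
    by simp
  moreover have "\<mu> * (norm d)\<^sup>2 \<le> 0" using \<mu> by (simp add: mult_nonpos_nonneg)
  moreover have "Re (\<L> \<mu> (\<Gamma> v) (\<Gamma> v)) = Re (h s s) - \<mu> * (norm s)\<^sup>2"
    using L_real [OF \<mu>(1), of "\<Gamma> v"] v by (simp add: s_def)
  ultimately show ?thesis
    using h_self(2) [of d] d by (simp add: cinner_self D_H1 del: of_real_power)
qed

text \<open>The lower estimate turns a Cauchy sequence of boundary values into a Cauchy sequence of
  solutions in \<open>H1\<close>; the upper estimate carries its convergence back through
  \<open>\<Gamma>\<close>.\<close>

lemma L_closed:
  assumes \<mu>: "complex_of_real \<mu> \<notin> \<Sigma>" "\<mu> < 0"
  shows "closed_form (\<Gamma> ` H1) (\<L> (complex_of_real \<mu>))"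
  unfolding closed_form_def
proof (intro conjI allI impI)
  let ?n = "form_norm (\<L> (complex_of_real \<mu>))"
  show nnL: "nonneg_form (\<Gamma> ` H1) (\<L> (complex_of_real \<mu>))"
    unfolding nonneg_form_def using sesquilinear_L [OF \<mu>(1)] L_nonneg [OF \<mu>(1)] \<mu>(2) by auto
  \<comment> \<open>The factor with \<open>c * (h + 1) \<le> h - \<mu>\<close> as quadratic forms;
    it is positive only because \<open>\<mu> < 0\<close>.\<close>
  define c where "c = min 1 (- \<mu>)"
  have c: "c > 0" "c \<le> 1" "c \<le> - \<mu>" using \<mu> by (auto simp: c_def)
  have lower: "sqrt c * nrm (S \<mu> \<phi>) \<le> ?n \<phi>" if \<phi>: "\<phi> \<in> \<Gamma> ` H1" for \<phi>
  proof -
    define u where "u = S \<mu> \<phi>"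
    have u: "u \<in> H1" unfolding u_def by (rule S_H1 [OF \<mu>(1) \<phi>])
    have "c * Re (h u u) \<le> 1 * Re (h u u)" "c * (norm u)\<^sup>2 \<le> (- \<mu>) * (norm u)\<^sup>2"
      using c h_self(2) [OF u] by (intro mult_right_mono; simp)+
    then have "c * (Re (h u u) + (norm u)\<^sup>2) \<le> Re (\<L> \<mu> \<phi> \<phi>)"
      by (simp add: L_real [OF \<mu>(1) \<phi>] u_def algebra_simps)
    also have "\<dots> \<le> Re (\<L> \<mu> \<phi> \<phi>) + (norm \<phi>)\<^sup>2" by simp
    finally show ?thesis by (simp add: form_norm_def u_def flip: real_sqrt_mult)
  qed
  obtain C where C: "C \<ge> 0" "\<And>x. x \<in> H1 \<Longrightarrow> norm (\<Gamma> x) \<le> C * nrm x" using \<Gamma>_bounded by blast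
  \<comment> \<open>\<open>1 - \<mu>\<close> bounds the form part through minimality,
    \<open>C\<^sup>2\<close> the boundary norm.\<close>
  define K where "K = 1 - \<mu> + C\<^sup>2"
  have upper: "?n (\<Gamma> v) \<le> sqrt K * nrm v" if v: "v \<in> H1" for v
  proof -
    have "(norm (\<Gamma> v))\<^sup>2 \<le> (C * nrm v)\<^sup>2" using C(2) [OF v] by (intro power_mono) auto
    moreover have "Re (h v v) - \<mu> * (norm v)\<^sup>2 \<le> (1 - \<mu>) * (nrm v)\<^sup>2"
      using h_self(2) [OF v] \<mu>(2) mult_nonpos_nonneg [of \<mu> "Re (h v v)"]
      by (simp add: form_norm_power2 [OF h_nonneg_form v] algebra_simps order_trans [of _ 0])
    ultimately have "Re (\<L> \<mu> (\<Gamma> v) (\<Gamma> v)) + (norm (\<Gamma> v))\<^sup>2 \<le> K * (nrm v)\<^sup>2"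
      using L_minimal [OF \<mu>(1) _ v] \<mu>(2) by (simp add: K_def power_mult_distrib algebra_simps)
    then have "?n (\<Gamma> v) \<le> sqrt (K * (nrm v)\<^sup>2)" by (simp add: form_norm_def)
    then show ?thesis using form_norm_nonneg [OF h_nonneg_form v] by (simp add: real_sqrt_mult)
  qed
  fix \<phi> :: "nat \<Rightarrow> 'g"
  assume a: "range \<phi> \<subseteq> \<Gamma> ` H1 \<and> (\<forall>e>0. \<exists>N. \<forall>m\<ge>N. \<forall>n\<ge>N. ?n (\<phi> m - \<phi> n) < e)"
  then have \<phi>: "\<phi> n \<in> \<Gamma> ` H1" for n by auto
  define x where "x n = S \<mu> (\<phi> n)" for n
  have xH: "x n \<in> H1" and \<Gamma>x: "\<Gamma> (x n) = \<phi> n" for n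
    using \<phi> \<mu> by (auto simp: x_def S_H1 \<Gamma>_S)
  have xd: "S \<mu> (\<phi> m - \<phi> n) = x m - x n" for m n
    using S_add [OF \<mu>(1), of "\<phi> m - \<phi> n" "\<phi> n"] \<phi> csubspace_diff [OF csubspace_range]
    by (simp add: x_def)
  have "\<exists>N. \<forall>m\<ge>N. \<forall>n\<ge>N. nrm (x m - x n) < e" if "e > 0" for e
  proof -
    have "sqrt c * e > 0" using c that by simp
    then obtain N where N: "\<And>m n. m \<ge> N \<Longrightarrow> n \<ge> N \<Longrightarrow> ?n (\<phi> m - \<phi> n) < sqrt c * e"
      using a by meson
    have "nrm (x m - x n) < e" if "m \<ge> N" "n \<ge> N" for m n
    proof -
      have "sqrt c * nrm (x m - x n) < sqrt c * e"
        using lower [of "\<phi> m - \<phi> n"] N [OF that] \<phi> csubspace_diff [OF csubspace_range]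
        by (metis order_le_less_trans xd)
      then show ?thesis using c by simp
    qed
    then show ?thesis by blast
  qed
  moreover have "range x \<subseteq> H1" using xH by auto
  ultimately obtain u where u: "u \<in> H1" "(\<lambda>n. nrm (x n - u)) \<longlonglongrightarrow> 0"
    using h_closed_form unfolding closed_form_def by blast
  have "(\<lambda>n. ?n (\<phi> n - \<Gamma> u)) \<longlonglongrightarrow> 0"
  proof (rule null_comparison)
    show "norm (?n (\<phi> n - \<Gamma> u)) \<le> sqrt K * nrm (x n - u)" for n
      using upper [of "x n - u"] xH [of n] u(1) form_norm_nonneg [OF nnL imageI [of "x n - u"]]
      by (simp add: H1_intros \<Gamma>_diff \<Gamma>x)
    show "(\<lambda>n. sqrt K * nrm (x n - u)) \<longlonglongrightarrow> 0"
      using tendsto_mult [OF tendsto_const u(2), of "sqrt K"] by simp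
  qed
  with u(1) show "\<exists>\<psi>\<in>\<Gamma> ` H1. (\<lambda>n. ?n (\<phi> n - \<psi>)) \<longlonglongrightarrow> 0" by blast
qed

end

section \<open>Holomorphy\<close>

text \<open>Formal power series carry the passage from a pointwise convergent expansion to
  holomorphy at the centre and to the values of all derivatives there.\<close>

lemma has_fps_expansion_power_series:
  fixes f :: "complex \<Rightarrow> complex"
  assumes "r > 0" "\<And>\<zeta>. cmod (\<zeta> - z) < r \<Longrightarrow> (\<lambda>n. a n * (\<zeta> - z) ^ n) sums f \<zeta>"
  shows "(\<lambda>x. f (x + z)) has_fps_expansion Abs_fps a"
proof (rule has_fps_expansionI)
  have "(\<lambda>n. a n * u ^ n) sums f (u + z)" if "cmod u < r" for u
    using assms(2) [of "u + z"] that by simp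
  then show "\<forall>\<^sub>F u in nhds 0. (\<lambda>n. fps_nth (Abs_fps a) n * u ^ n) sums f (u + z)"
    unfolding eventually_nhds_metric using assms(1) by (intro exI [of _ r]) (auto simp: dist_norm)
qed

lemma power_series_higher_deriv:
  fixes f :: "complex \<Rightarrow> complex"
  assumes "r > 0" "\<And>\<zeta>. cmod (\<zeta> - z) < r \<Longrightarrow> (\<lambda>n. a n * (\<zeta> - z) ^ n) sums f \<zeta>"
  shows "(deriv ^^ n) f z = fact n * a n"
proof -
  have "a n = (deriv ^^ n) (\<lambda>x. f (x + z)) 0 / fact n"
    using fps_nth_fps_expansion [OF has_fps_expansion_power_series [OF assms], of n] by simp
  then show ?thesis
    by (simp add: higher_deriv_shift_0 [of n f z] o_def add.commute)
qed

lemma power_series_field_differentiable: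
  fixes f :: "complex \<Rightarrow> complex"
  assumes "r > 0" "\<And>\<zeta>. cmod (\<zeta> - z) < r \<Longrightarrow> (\<lambda>n. a n * (\<zeta> - z) ^ n) sums f \<zeta>"
  shows "f field_differentiable at z"
proof -
  obtain s where s: "open s" "0 \<in> s" "(\<lambda>x. f (x + z)) holomorphic_on s"
    by (rule has_fps_expansion_imp_holomorphic [OF has_fps_expansion_power_series [OF assms]])
  then obtain d where "((\<lambda>x. f (x + z)) has_field_derivative d) (at 0)"
    using holomorphic_on_imp_differentiable_at field_differentiable_def by blast
  then have "(f has_field_derivative d) (at (0 + z))" by (simp only: DERIV_shift)
  then show ?thesis unfolding field_differentiable_def by auto
qed

section \<open>Neumann series of the solution operator and Taylor expansion of the form\<close>

context boundary_setting
begin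

lemma R_pow_add: "z \<notin> \<Sigma> \<Longrightarrow> (R z ^^ n) (f + g) = (R z ^^ n) f + (R z ^^ n) g"
  by (induction n) (simp_all add: R_add)

lemma R_pow_scaleC: "z \<notin> \<Sigma> \<Longrightarrow> (R z ^^ n) (c *\<^sub>C f) = c *\<^sub>C (R z ^^ n) f"
  by (induction n) (simp_all add: R_scaleC)

lemma R_pow_bounded:
  assumes "M > 0" "\<And>f. norm (R z f) \<le> M * norm f"
  shows "norm ((R z ^^ n) f) \<le> M ^ n * norm f"
proof (induction n)
  case (Suc n)
  have "norm (R z ((R z ^^ n) f)) \<le> M * (M ^ n * norm f)"
    using assms(1) by (intro order_trans [OF assms(2)] mult_left_mono Suc.IH) simp
  then show ?case by (simp add: mult.assoc)
qed simp

text \<open>Iterating \<open>S \<zeta> \<phi> = S z \<phi> + (\<zeta> - z) R z (S \<zeta> \<phi>)\<close> gives the Neumann series; only the resolvent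
  at the centre \<open>z\<close> enters, so no bound on \<open>R \<zeta>\<close> is needed.\<close>

lemma S_Neumann_series:
  assumes z: "z \<notin> \<Sigma>" and \<zeta>: "\<zeta> \<notin> \<Sigma>" and \<phi>: "\<phi> \<in> \<Gamma> ` H1"
    and M: "M > 0" "\<And>f. norm (R z f) \<le> M * norm f" and small: "cmod (\<zeta> - z) * M < 1"
  shows "(\<lambda>n. (\<zeta> - z) ^ n * cinner ((R z ^^ n) (S z \<phi>)) v) sums cinner (S \<zeta> \<phi>) v"
proof -
  define s s0 d where "s = S \<zeta> \<phi>" and "s0 = S z \<phi>" and "d = \<zeta> - z"
  have s: "s = s0 + d *\<^sub>C R z s"
    using S_shift [OF z \<zeta> \<phi>] scaleC_add_left [of "\<zeta> - z" "z - \<zeta>" "R z s"]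
    by (simp add: s_def s0_def d_def add.assoc add.commute)
  \<comment> \<open>The exact remainder contains the fixed vector \<open>s\<close>, so it decays
    geometrically with ratio \<open>cmod d * M\<close>.\<close>
  have rest: "cinner s v - (\<Sum>j<n. d ^ j * cinner ((R z ^^ j) s0) v) = d ^ n * cinner ((R z ^^ n) s) v" for n
  proof (induction n)
    case (Suc n)
    have "(R z ^^ n) s = (R z ^^ n) s0 + d *\<^sub>C (R z ^^ Suc n) s"
      using arg_cong [OF s, of "R z ^^ n"]
      by (simp only: R_pow_add [OF z] R_pow_scaleC [OF z] funpow_Suc_right o_apply)
    then have "cinner ((R z ^^ n) s) v = cinner ((R z ^^ n) s0) v + d * cinner ((R z ^^ Suc n) s) v"
      by (metis cinner_add_left cinner_scaleC_left)
    with Suc show ?case by (simp add: algebra_simps)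
  qed simp
  have "(\<lambda>n. cinner s v - (\<Sum>j<n. d ^ j * cinner ((R z ^^ j) s0) v)) \<longlonglongrightarrow> 0"
  proof (rule null_comparison)
    fix n
    have "cmod (cinner ((R z ^^ n) s) v) \<le> M ^ n * norm s * norm v"
      by (rule order_trans [OF cinner_Cauchy_Schwarz])
        (intro mult_right_mono R_pow_bounded M norm_ge_zero)
    then have "cmod d ^ n * cmod (cinner ((R z ^^ n) s) v) \<le> cmod d ^ n * (M ^ n * norm s * norm v)"
      by (rule mult_left_mono) simp
    then show "norm (cinner s v - (\<Sum>j<n. d ^ j * cinner ((R z ^^ j) s0) v))
        \<le> (cmod d * M) ^ n * (norm s * norm v)"
      unfolding rest by (simp add: norm_mult norm_power power_mult_distrib mult.assoc)
  next
    have "(\<lambda>n. (cmod d * M) ^ n) \<longlonglongrightarrow> 0"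
      using small M(1) by (intro LIMSEQ_realpow_zero) (simp_all add: d_def)
    then show "(\<lambda>n. (cmod d * M) ^ n * (norm s * norm v)) \<longlonglongrightarrow> 0"
      by (rule tendsto_mult_left_zero)
  qed
  then have "(\<lambda>n. cinner s v - (cinner s v - (\<Sum>j<n. d ^ j * cinner ((R z ^^ j) s0) v)))
      \<longlonglongrightarrow> cinner s v - 0"
    by (intro tendsto_diff tendsto_const)
  then show ?thesis by (simp add: sums_def s_def s0_def d_def)
qed

text \<open>Taylor coefficients at \<open>z\<close>. The exponent \<open>n - 1\<close> stems from
  the factor \<open>\<zeta> - z\<close> in the difference formula, which raises each Neumann term by
  one degree.\<close>

definition L_coeff :: "complex \<Rightarrow> 'g \<Rightarrow> 'g \<Rightarrow> nat \<Rightarrow> complex"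
  where "L_coeff z \<phi> \<psi> n = (if n = 0 then \<L> z \<phi> \<psi>
    else - cinner ((R z ^^ (n - 1)) (S z \<phi>)) (S (cnj z) \<psi>))"

text \<open>The radius \<open>1 / M\<close> does two things: it keeps the disc outside the spectrum
  and makes the Neumann series converge.\<close>

lemma L_power_series:
  assumes z: "z \<notin> \<Sigma>" and \<phi>: "\<phi> \<in> \<Gamma> ` H1" and \<psi>: "\<psi> \<in> \<Gamma> ` H1"
  obtains r where "r > 0" "\<And>\<zeta>. cmod (\<zeta> - z) < r \<Longrightarrow> (\<lambda>n. L_coeff z \<phi> \<psi> n * (\<zeta> - z) ^ n) sums \<L> \<zeta> \<phi> \<psi>"
proof -
  obtain M where M: "M > 0" "\<And>f. norm (R z f) \<le> M * norm f" using R_bounded [OF z] by blast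
  show thesis
  proof (rule that [of "1 / M"])
    fix \<zeta> assume "cmod (\<zeta> - z) < 1 / M"
    then have small: "cmod (\<zeta> - z) * M < 1" using M(1) by (simp add: pos_less_divide_eq)
    have \<zeta>: "\<zeta> \<notin> \<Sigma>" by (rule near_not_spectrum [OF z M small])
    let ?v = "S (cnj z) \<psi>"
    have "(\<lambda>n. - (\<zeta> - z) * ((\<zeta> - z) ^ n * cinner ((R z ^^ n) (S z \<phi>)) ?v)) sums
        (- (\<zeta> - z) * cinner (S \<zeta> \<phi>) ?v)"
      by (rule sums_mult [OF S_Neumann_series [OF z \<zeta> \<phi> M small]])
    also have "- (\<zeta> - z) * cinner (S \<zeta> \<phi>) ?v = \<L> \<zeta> \<phi> \<psi> - \<L> z \<phi> \<psi>"
      by (rule L_diff [OF \<zeta> z \<phi> \<psi>, symmetric])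
    also have "(\<lambda>n. - (\<zeta> - z) * ((\<zeta> - z) ^ n * cinner ((R z ^^ n) (S z \<phi>)) ?v)) =
        (\<lambda>n. L_coeff z \<phi> \<psi> (Suc n) * (\<zeta> - z) ^ Suc n)"
      by (simp add: L_coeff_def fun_eq_iff mult_ac del: minus_diff_eq)
    finally have "(\<lambda>n. L_coeff z \<phi> \<psi> n * (\<zeta> - z) ^ n) sums
        (\<L> \<zeta> \<phi> \<psi> - \<L> z \<phi> \<psi> + L_coeff z \<phi> \<psi> 0 * (\<zeta> - z) ^ 0)"
      by (rule sums_Suc)
    then show "(\<lambda>n. L_coeff z \<phi> \<psi> n * (\<zeta> - z) ^ n) sums \<L> \<zeta> \<phi> \<psi>"
      by (simp add: L_coeff_def)
  qed (use M in simp)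
qed

lemma L_higher_deriv:
  assumes "z \<notin> \<Sigma>" "\<phi> \<in> \<Gamma> ` H1" "\<psi> \<in> \<Gamma> ` H1" "k \<ge> 1"
  shows "(deriv ^^ k) (\<lambda>\<zeta>. \<L> \<zeta> \<phi> \<psi>) z
    = - fact k * cinner ((R z ^^ (k - 1)) (S z \<phi>)) (S (cnj z) \<psi>)"
proof -
  obtain r where r: "r > 0"
    "\<And>\<zeta>. cmod (\<zeta> - z) < r \<Longrightarrow> (\<lambda>n. L_coeff z \<phi> \<psi> n * (\<zeta> - z) ^ n) sums \<L> \<zeta> \<phi> \<psi>"
    using L_power_series [OF assms(1-3)] by blast
  show ?thesis
    using power_series_higher_deriv [OF r, of k] assms(4) by (simp add: L_coeff_def)
qed

lemma L_deriv:
  assumes "z \<notin> \<Sigma>" "\<phi> \<in> \<Gamma> ` H1" "\<psi> \<in> \<Gamma> ` H1"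
  shows "deriv (\<lambda>\<zeta>. \<L> \<zeta> \<phi> \<psi>) z = - cinner (S z \<phi>) (S (cnj z) \<psi>)"
  using L_higher_deriv [OF assms, of 1] by simp

lemma L_field_differentiable:
  assumes "z \<notin> \<Sigma>" "\<phi> \<in> \<Gamma> ` H1" "\<psi> \<in> \<Gamma> ` H1"
  shows "(\<lambda>\<zeta>. \<L> \<zeta> \<phi> \<psi>) field_differentiable at z"
proof -
  obtain r where r: "r > 0"
    "\<And>\<zeta>. cmod (\<zeta> - z) < r \<Longrightarrow> (\<lambda>n. L_coeff z \<phi> \<psi> n * (\<zeta> - z) ^ n) sums \<L> \<zeta> \<phi> \<psi>"
    using L_power_series [OF assms] by blast
  show ?thesis by (rule power_series_field_differentiable [OF r])
qed

lemma L_holomorphic: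
  assumes "\<phi> \<in> \<Gamma> ` H1" "\<psi> \<in> \<Gamma> ` H1"
  shows "(\<lambda>\<zeta>. \<L> \<zeta> \<phi> \<psi>) holomorphic_on - \<Sigma>"
  using L_field_differentiable assms
  by (auto simp: holomorphic_on_def intro: field_differentiable_at_within)

lemma higher_deriv_sesquilinear:
  assumes z: "z \<notin> \<Sigma>" and k: "k \<ge> 1"
  shows "sesquilinear_on (\<Gamma> ` H1) (\<lambda>\<phi> \<psi>. (deriv ^^ k) (\<lambda>\<zeta>. \<L> \<zeta> \<phi> \<psi>) z)"
  unfolding sesquilinear_on_def
  by (intro conjI ballI allI csubspace_range)
    (simp_all add: L_higher_deriv [OF z _ _ k] csubspace_add [OF csubspace_range]
      csubspace_scaleC [OF csubspace_range] S_add z cnj_not_spectrum S_scaleC R_pow_add R_pow_scaleC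
      cinner_simps algebra_simps)

lemma S_norm_bounded:
  assumes z: "z \<notin> \<Sigma>"
  obtains B where "B \<ge> 0" "\<And>\<phi>. \<phi> \<in> \<Gamma> ` H1 \<Longrightarrow> norm (S z \<phi>) \<le> B * hnrm \<phi>"
proof -
  obtain B where B: "\<And>\<phi>. \<phi> \<in> \<Gamma> ` H1 \<Longrightarrow> nrm (S z \<phi>) \<le> B * hnrm \<phi>"
    using S_bounded [OF z] unfolding bounded_map_on_def by blast
  show thesis
  proof (rule that [of "max B 0"])
    fix \<phi> assume \<phi>: "\<phi> \<in> \<Gamma> ` H1"
    have "norm (S z \<phi>) \<le> B * hnrm \<phi>"
      using B [OF \<phi>] norm_le_form_norm [OF h_nonneg_form S_H1 [OF z \<phi>]] by simp
    also have "\<dots> \<le> max B 0 * hnrm \<phi>"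
      by (intro mult_right_mono hnrm_nonneg \<phi>) simp
    finally show "norm (S z \<phi>) \<le> max B 0 * hnrm \<phi>" .
  qed simp
qed

lemma higher_deriv_bounded:
  assumes z: "z \<notin> \<Sigma>" and k: "k \<ge> 1"
  shows "bounded_form_on (\<Gamma> ` H1) hnrm (\<lambda>\<phi> \<psi>. (deriv ^^ k) (\<lambda>\<zeta>. \<L> \<zeta> \<phi> \<psi>) z)"
proof -
  obtain M where M: "M > 0" "\<And>f. norm (R z f) \<le> M * norm f" using R_bounded [OF z] by blast
  obtain B where B: "B \<ge> 0" "\<And>\<phi>. \<phi> \<in> \<Gamma> ` H1 \<Longrightarrow> norm (S z \<phi>) \<le> B * hnrm \<phi>"
    using S_norm_bounded [OF z] by blast
  obtain B' where B': "B' \<ge> 0" "\<And>\<phi>. \<phi> \<in> \<Gamma> ` H1 \<Longrightarrow> norm (S (cnj z) \<phi>) \<le> B' * hnrm \<phi>"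
    using S_norm_bounded [OF cnj_not_spectrum [OF z]] by blast
  have "cmod ((deriv ^^ k) (\<lambda>\<zeta>. \<L> \<zeta> \<phi> \<psi>) z) \<le> (fact k * (M ^ (k - 1) * B * B')) * hnrm \<phi> * hnrm \<psi>"
    if \<phi>: "\<phi> \<in> \<Gamma> ` H1" and \<psi>: "\<psi> \<in> \<Gamma> ` H1" for \<phi> \<psi>
  proof -
    have "norm ((R z ^^ (k - 1)) (S z \<phi>)) \<le> M ^ (k - 1) * (B * hnrm \<phi>)"
      using M by (intro order_trans [OF R_pow_bounded [OF M]] mult_left_mono B \<phi>) simp
    then have "norm ((R z ^^ (k - 1)) (S z \<phi>)) * norm (S (cnj z) \<psi>)
        \<le> (M ^ (k - 1) * (B * hnrm \<phi>)) * (B' * hnrm \<psi>)"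
      using M B B' \<psi> \<phi> hnrm_nonneg by (intro mult_mono) auto
    with cinner_Cauchy_Schwarz have "cmod (cinner ((R z ^^ (k - 1)) (S z \<phi>)) (S (cnj z) \<psi>))
        \<le> (M ^ (k - 1) * (B * hnrm \<phi>)) * (B' * hnrm \<psi>)"
      by (rule order_trans)
    then have "fact k * cmod (cinner ((R z ^^ (k - 1)) (S z \<phi>)) (S (cnj z) \<psi>))
        \<le> fact k * ((M ^ (k - 1) * (B * hnrm \<phi>)) * (B' * hnrm \<psi>))"
      by (rule mult_left_mono) simp
    then show ?thesis
      by (simp add: L_higher_deriv [OF z \<phi> \<psi> k] norm_mult mult_ac)
  qed
  then show ?thesis unfolding bounded_form_on_def by blast
qed

section \<open>Monotonicity on real intervals and the sign of the imaginary part\<close>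

lemma L_deriv_real:
  assumes "complex_of_real \<mu> \<notin> \<Sigma>" "\<phi> \<in> \<Gamma> ` H1"
  shows "deriv (\<lambda>\<zeta>. \<L> \<zeta> \<phi> \<phi>) (complex_of_real \<mu>) = - complex_of_real ((norm (S \<mu> \<phi>))\<^sup>2)"
  using L_deriv [OF assms(1,2,2)] by (simp add: cinner_self)

text \<open>The derivative along the real axis is minus the squared norm of
  \<open>S \<nu> \<phi>\<close>. The mean value argument needs it at every point, so the whole
  interval must avoid the spectrum.\<close>

lemma L_antimono:
  assumes le: "\<mu>\<^sub>1 \<le> \<mu>\<^sub>2" and ns: "\<And>\<nu>. \<nu> \<in> {\<mu>\<^sub>1..\<mu>\<^sub>2} \<Longrightarrow> complex_of_real \<nu> \<notin> \<Sigma>" and \<phi>: "\<phi> \<in> \<Gamma> ` H1"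
  shows "\<L> (complex_of_real \<mu>\<^sub>2) \<phi> \<phi> \<le> \<L> (complex_of_real \<mu>\<^sub>1) \<phi> \<phi>"
proof -
  have "\<exists>y. ((\<lambda>\<nu>. Re (\<L> (complex_of_real \<nu>) \<phi> \<phi>)) has_real_derivative y) (at \<nu>) \<and> y \<le> 0"
    if "\<mu>\<^sub>1 \<le> \<nu>" "\<nu> \<le> \<mu>\<^sub>2" for \<nu>
  proof -
    have \<nu>: "complex_of_real \<nu> \<notin> \<Sigma>" using ns that by simp
    have "((\<lambda>\<zeta>. \<L> \<zeta> \<phi> \<phi>) has_field_derivative deriv (\<lambda>\<zeta>. \<L> \<zeta> \<phi> \<phi>) (complex_of_real \<nu>))
        (at (complex_of_real \<nu>))"
      using L_field_differentiable [OF \<nu> \<phi> \<phi>] by (simp add: DERIV_deriv_iff_field_differentiable)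
    then have "((\<lambda>t. \<L> (complex_of_real t) \<phi> \<phi>) has_vector_derivative
        deriv (\<lambda>\<zeta>. \<L> \<zeta> \<phi> \<phi>) (complex_of_real \<nu>)) (at \<nu>)"
      by (rule has_vector_derivative_real_field)
    then have "((\<lambda>t. Re (\<L> (complex_of_real t) \<phi> \<phi>)) has_vector_derivative
        Re (deriv (\<lambda>\<zeta>. \<L> \<zeta> \<phi> \<phi>) (complex_of_real \<nu>))) (at \<nu>)"
      by (rule bounded_linear.has_vector_derivative [OF bounded_linear_Re])
    then show ?thesis
      unfolding has_real_derivative_iff_has_vector_derivative
      by (intro exI conjI) (assumption, simp add: L_deriv_real [OF \<nu> \<phi>] del: of_real_power)
  qed
  then have "Re (\<L> (complex_of_real \<mu>\<^sub>2) \<phi> \<phi>) \<le> Re (\<L> (complex_of_real \<mu>\<^sub>1) \<phi> \<phi>)"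
    by (intro DERIV_nonpos_imp_nonincreasing [OF le, of "\<lambda>\<nu>. Re (\<L> (complex_of_real \<nu>) \<phi> \<phi>)"]) auto
  then show ?thesis
    using L_real [OF ns \<phi>, of \<mu>\<^sub>1] L_real [OF ns \<phi>, of \<mu>\<^sub>2] le by (simp add: less_eq_complex_def)
qed

text \<open>With \<open>w = cnj z\<close> both solutions in the difference formula become
  \<open>S z \<phi>\<close>, and \<open>z - cnj z\<close> is \<open>2 * \<i>\<close> times
  \<open>Im z\<close>.\<close>

lemma L_Im:
  assumes z: "z \<notin> \<Sigma>" and \<phi>: "\<phi> \<in> \<Gamma> ` H1"
  shows "form_Im (\<L> z) \<phi> \<phi> = - complex_of_real (Im z * (norm (S z \<phi>))\<^sup>2)"
proof -
  have "\<L> z \<phi> \<phi> - form_adj (\<L> z) \<phi> \<phi> = - (z - cnj z) * complex_of_real ((norm (S z \<phi>))\<^sup>2)"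
    using L_diff [OF z cnj_not_spectrum [OF z] \<phi> \<phi>] L_adjoint [OF z \<phi> \<phi>]
    by (simp add: form_adj_def cinner_self)
  also have "\<dots> = - complex_of_real (Im z * (norm (S z \<phi>))\<^sup>2) * (2 * \<i>)"
    by (simp add: complex_diff_cnj)
  finally show ?thesis
    unfolding form_Im_def by (metis complex_i_not_zero mult_eq_0_iff nonzero_divide_eq_eq zero_neq_numeral)
qed

lemma nevanlinna_minus_L:
  "nevanlinna_form_family (- \<Sigma>) (\<Gamma> ` H1) (\<lambda>\<zeta> \<phi> \<psi>. - \<L> \<zeta> \<phi> \<psi>)"
  unfolding nevanlinna_form_family_def
proof (intro conjI ballI impI)
  fix z assume "z \<in> - \<Sigma>"
  then have z: "z \<notin> \<Sigma>" by simp
  show "sesquilinear_on (\<Gamma> ` H1) (\<lambda>\<phi> \<psi>. - \<L> z \<phi> \<psi>)"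
    using sesquilinear_L [OF z] by (simp add: sesquilinear_on_def)
  show "form_adj (\<lambda>\<phi> \<psi>. - \<L> z \<phi> \<psi>) \<phi> \<psi> = - \<L> (cnj z) \<phi> \<psi>"
    if "\<phi> \<in> \<Gamma> ` H1" "\<psi> \<in> \<Gamma> ` H1" for \<phi> \<psi>
    using L_adjoint [OF z that] by (simp add: form_adj_def)
  fix \<phi> assume "0 < Im z" and \<phi>: "\<phi> \<in> \<Gamma> ` H1"
  have "form_Im (\<lambda>\<phi> \<psi>. - \<L> z \<phi> \<psi>) \<phi> \<phi> = - form_Im (\<L> z) \<phi> \<phi>"
    unfolding form_Im_def form_adj_def minus_divide_left
    by (rule arg_cong [of _ _ "\<lambda>x. x / (2 * \<i>)"]) simp
  with \<open>0 < Im z\<close> show "0 \<le> form_Im (\<lambda>\<phi> \<psi>. - \<L> z \<phi> \<psi>) \<phi> \<phi>"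
    by (simp add: L_Im [OF z \<phi>] less_eq_complex_def del: of_real_mult of_real_power)
qed (auto intro!: holomorphic_intros L_holomorphic)

end

theorem theorem2p23:
  fixes H1 :: "'h::complex_hilbert_space set"
    and h :: "'h \<Rightarrow> 'h \<Rightarrow> complex"
    and \<Gamma> :: "'h \<Rightarrow> 'g::complex_hilbert_space"
    and z w :: complex
    and \<mu> :: real
  assumes bp: "boundary_pair H1 h \<Gamma>"
    and z: "z \<notin> dir_spectrum H1 h \<Gamma>"
    and w: "w \<notin> dir_spectrum H1 h \<Gamma>"
    and \<mu>: "complex_of_real \<mu> \<notin> dir_spectrum H1 h \<Gamma>"
  shows
    "\<comment> \<open>(i)\<close>
     ((\<forall>\<phi>\<in>\<Gamma> ` H1. \<forall>\<psi>\<in>\<Gamma> ` H1.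
        (\<forall>g\<in>H1. \<forall>g'\<in>H1. \<Gamma> g = \<psi> \<and> \<Gamma> g' = \<psi> \<longrightarrow>
          shifted_form h z (dir_solution H1 h \<Gamma> z \<phi>) g =
          shifted_form h z (dir_solution H1 h \<Gamma> z \<phi>) g') \<and>
        (\<forall>g\<in>H1. \<Gamma> g = \<psi> \<longrightarrow>
          dtn_form H1 h \<Gamma> z \<phi> \<psi> = shifted_form h z (dir_solution H1 h \<Gamma> z \<phi>) g))
     \<and> sesquilinear_on (\<Gamma> ` H1) (dtn_form H1 h \<Gamma> z)
     \<and> (\<forall>\<phi>\<in>\<Gamma> ` H1. \<forall>\<psi>\<in>\<Gamma> ` H1.
          form_adj (dtn_form H1 h \<Gamma> z) \<phi> \<psi> = dtn_form H1 h \<Gamma> (cnj z) \<phi> \<psi>))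
     \<and>
     \<comment> \<open>(ii)\<close>
     (\<forall>\<phi>\<in>\<Gamma> ` H1. \<forall>\<psi>\<in>\<Gamma> ` H1.
        dtn_form H1 h \<Gamma> z \<phi> \<psi> - dtn_form H1 h \<Gamma> w \<phi> \<psi> =
          - (z - w) * cinner (dir_solution H1 h \<Gamma> z \<phi>) (dir_solution H1 h \<Gamma> (cnj w) \<psi>) \<and>
        - (z - w) * cinner (dir_solution H1 h \<Gamma> z \<phi>) (dir_solution H1 h \<Gamma> (cnj w) \<psi>) =
          - (z - w) * cinner (dir_solution H1 h \<Gamma> w \<phi>) (dir_solution H1 h \<Gamma> (cnj z) \<psi>))
     \<and>
     \<comment> \<open>(iii); the first two conjuncts say that the operator norms in it are finite\<close>
     (bounded_map_on (\<Gamma> ` H1) (half_norm H1 h \<Gamma>) (form_norm h) (dir_solution H1 h \<Gamma> z)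
     \<and> bounded_map_on H1 (form_norm h) (form_norm h) (C1_op H1 h \<Gamma> z (-1))
     \<and> (\<forall>\<phi>\<in>\<Gamma> ` H1. \<forall>\<psi>\<in>\<Gamma> ` H1.
          cmod (dtn_form H1 h \<Gamma> z \<phi> \<psi>)
            \<le> L_bound H1 h \<Gamma> z * half_norm H1 h \<Gamma> \<phi> * half_norm H1 h \<Gamma> \<psi>)
     \<and> L_bound H1 h \<Gamma> z \<le> 1 + cmod (z + 1) * C1_norm H1 h \<Gamma> z (-1))
     \<and>
     \<comment> \<open>(iv)\<close>
     ((\<mu> \<le> 0 \<longrightarrow> (\<forall>\<phi>\<in>\<Gamma> ` H1. 0 \<le> dtn_form H1 h \<Gamma> (complex_of_real \<mu>) \<phi> \<phi>))
     \<and> (\<mu> < 0 \<longrightarrow> closed_form (\<Gamma> ` H1) (dtn_form H1 h \<Gamma> (complex_of_real \<mu>))))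
     \<and>
     \<comment> \<open>(v); the whole interval has to avoid the spectrum: monotonicity fails across the
       poles of the family\<close>
     (\<forall>\<mu>\<^sub>1 \<mu>\<^sub>2 :: real.
        \<mu>\<^sub>1 \<le> \<mu>\<^sub>2 \<and>
        (\<forall>\<nu>\<in>{\<mu>\<^sub>1..\<mu>\<^sub>2}. complex_of_real \<nu> \<notin> dir_spectrum H1 h \<Gamma>) \<longrightarrow>
        (\<forall>\<phi>\<in>\<Gamma> ` H1. dtn_form H1 h \<Gamma> (complex_of_real \<mu>\<^sub>2) \<phi> \<phi>
                       \<le> dtn_form H1 h \<Gamma> (complex_of_real \<mu>\<^sub>1) \<phi> \<phi>))
     \<and>
     \<comment> \<open>(vi)\<close>
     ((\<forall>\<phi>\<in>\<Gamma> ` H1. \<forall>\<psi>\<in>\<Gamma> ` H1.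
        (\<lambda>\<zeta>. dtn_form H1 h \<Gamma> \<zeta> \<phi> \<psi>) holomorphic_on (- dir_spectrum H1 h \<Gamma>))
     \<and> (\<forall>k\<ge>1.
          sesquilinear_on (\<Gamma> ` H1) (\<lambda>\<phi> \<psi>. (deriv ^^ k) (\<lambda>\<zeta>. dtn_form H1 h \<Gamma> \<zeta> \<phi> \<psi>) z) \<and>
          bounded_form_on (\<Gamma> ` H1) (half_norm H1 h \<Gamma>)
            (\<lambda>\<phi> \<psi>. (deriv ^^ k) (\<lambda>\<zeta>. dtn_form H1 h \<Gamma> \<zeta> \<phi> \<psi>) z))
     \<and> (\<forall>\<phi>\<in>\<Gamma> ` H1. \<forall>\<psi>\<in>\<Gamma> ` H1.
          deriv (\<lambda>\<zeta>. dtn_form H1 h \<Gamma> \<zeta> \<phi> \<psi>) z =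
            - cinner (dir_solution H1 h \<Gamma> z \<phi>) (dir_solution H1 h \<Gamma> (cnj z) \<psi>))
     \<and> (\<forall>k\<ge>1. \<forall>\<phi>\<in>\<Gamma> ` H1. \<forall>\<psi>\<in>\<Gamma> ` H1.
          (deriv ^^ k) (\<lambda>\<zeta>. dtn_form H1 h \<Gamma> \<zeta> \<phi> \<psi>) z =
            - fact k * cinner ((dir_resolvent H1 h \<Gamma> z ^^ (k - 1)) (dir_solution H1 h \<Gamma> z \<phi>))
                              (dir_solution H1 h \<Gamma> (cnj z) \<psi>))
     \<and> (\<forall>\<phi>\<in>\<Gamma> ` H1. deriv (\<lambda>\<zeta>. dtn_form H1 h \<Gamma> \<zeta> \<phi> \<phi>) (complex_of_real \<mu>) \<le> 0))
     \<and>
     \<comment> \<open>(vii)\<close>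
     ((\<forall>\<phi>\<in>\<Gamma> ` H1.
        form_Im (dtn_form H1 h \<Gamma> z) \<phi> \<phi> =
          - complex_of_real (Im z * (norm (dir_solution H1 h \<Gamma> z \<phi>))\<^sup>2) \<and>
        (0 \<le> Im z \<longrightarrow> form_Im (dtn_form H1 h \<Gamma> z) \<phi> \<phi> \<le> 0))
     \<and> nevanlinna_form_family (- dir_spectrum H1 h \<Gamma>) (\<Gamma> ` H1)
          (\<lambda>\<zeta> \<phi> \<psi>. - dtn_form H1 h \<Gamma> \<zeta> \<phi> \<psi>))"
proof -
  interpret boundary_setting H1 h \<Gamma> by (unfold_locales) (rule bp)
  have diff: "\<L> z \<phi> \<psi> - \<L> w \<phi> \<psi> = - (z - w) * cinner (S z \<phi>) (S (cnj w) \<psi>) \<and>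
      - (z - w) * cinner (S z \<phi>) (S (cnj w) \<psi>) = - (z - w) * cinner (S w \<phi>) (S (cnj z) \<psi>)"
    if "\<phi> \<in> \<Gamma> ` H1" "\<psi> \<in> \<Gamma> ` H1" for \<phi> \<psi>
    using L_diff [OF z w that] L_diff' [OF z w that] by (intro conjI) (assumption, metis)
  show ?thesis
  proof (intro conjI)
    show "\<forall>\<phi>\<in>\<Gamma> ` H1. \<forall>\<psi>\<in>\<Gamma> ` H1.
        (\<forall>g\<in>H1. \<forall>g'\<in>H1. \<Gamma> g = \<psi> \<and> \<Gamma> g' = \<psi> \<longrightarrow>
          shifted_form h z (S z \<phi>) g = shifted_form h z (S z \<phi>) g') \<and>
        (\<forall>g\<in>H1. \<Gamma> g = \<psi> \<longrightarrow> \<L> z \<phi> \<psi> = shifted_form h z (S z \<phi>) g)"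
      using shifted_form_diff_range [OF z] L_eq [OF z] by metis
    show "\<forall>\<phi>\<in>\<Gamma> ` H1. \<forall>\<psi>\<in>\<Gamma> ` H1. form_adj (\<L> z) \<phi> \<psi> = \<L> (cnj z) \<phi> \<psi>"
      using L_adjoint [OF z] by (simp add: form_adj_def)
    show "\<forall>\<phi>\<in>\<Gamma> ` H1. form_Im (\<L> z) \<phi> \<phi> = - complex_of_real (Im z * (norm (S z \<phi>))\<^sup>2) \<and>
        (0 \<le> Im z \<longrightarrow> form_Im (\<L> z) \<phi> \<phi> \<le> 0)"
      using L_Im [OF z] by (simp add: less_eq_complex_def del: of_real_mult of_real_power)
    show "\<forall>\<phi>\<in>\<Gamma> ` H1. deriv (\<lambda>\<zeta>. \<L> \<zeta> \<phi> \<phi>) (complex_of_real \<mu>) \<le> 0"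
      using L_deriv_real [OF \<mu>] by (simp add: less_eq_complex_def del: of_real_power)
    show "\<forall>\<mu>\<^sub>1 \<mu>\<^sub>2. \<mu>\<^sub>1 \<le> \<mu>\<^sub>2 \<and> (\<forall>\<nu>\<in>{\<mu>\<^sub>1..\<mu>\<^sub>2}. complex_of_real \<nu> \<notin> \<Sigma>) \<longrightarrow>
        (\<forall>\<phi>\<in>\<Gamma> ` H1. \<L> (complex_of_real \<mu>\<^sub>2) \<phi> \<phi> \<le> \<L> (complex_of_real \<mu>\<^sub>1) \<phi> \<phi>)"
      using L_antimono by blast
    show "\<forall>k\<ge>1. sesquilinear_on (\<Gamma> ` H1) (\<lambda>\<phi> \<psi>. (deriv ^^ k) (\<lambda>\<zeta>. \<L> \<zeta> \<phi> \<psi>) z) \<and>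
        bounded_form_on (\<Gamma> ` H1) hnrm (\<lambda>\<phi> \<psi>. (deriv ^^ k) (\<lambda>\<zeta>. \<L> \<zeta> \<phi> \<psi>) z)"
      by (intro allI impI conjI higher_deriv_sesquilinear higher_deriv_bounded z)
  qed (intro allI ballI impI sesquilinear_L diff S_bounded C1_op_bounded L_bounded L_bound_le
      L_nonneg L_closed L_holomorphic L_deriv L_higher_deriv nevanlinna_minus_L z \<mu>; assumption)+
qed

end
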